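(* Let $H : {\rm Dom}(H) \to L^2(\mathbb{R}^-)$ be the operator $(Hw)(z) = -z w_{zz} - 3 w_z + \frac14 (z^2 w)_z$, $z<0$, with ${\rm Dom}(H) = \{ w \in L^2(\mathbb{R}^-) : Hw \in L^2(\mathbb{R}^-)\}$. For every $w \in {\rm Dom}(H) \subset L^2(\mathbb{R}^-)$, we have $$\langle Hw, w \rangle_{L^2(\mathbb{R}^-)} = - [w(0)]^2 + \int_{-\infty}^0 \left[ z (\partial_z w)^2 + \frac{1}{4} z w^2 \right] dz \leq -\frac{1}{2} \| w \|_{L^2(\mathbb{R}^-)}^2.$$
   Context: $\mathbb{R}^- = (-\infty,0)$; functions are real-valued; $w(0)$ denotes the boundary value of $w$ at $z=0$. No boundary condition is imposed at $z=0$ in the definition of ${\rm Dom}(H)$. *)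

theory Defs
  imports "HOL-Analysis.Analysis"
begin

text \<open>Elements of \<open>L\<^sup>2(-\<infinity>,0)\<close> are represented by real functions on the whole line; only their
  values on \<open>{..<0}\<close>, up to null sets, are relevant.\<close>

abbreviation leb_neg :: "real measure" where
  "leb_neg \<equiv> lebesgue_on {..<0}"

definition L2_neg :: "(real \<Rightarrow> real) set" where
  "L2_neg = {w. w \<in> borel_measurable leb_neg \<and> integrable leb_neg (\<lambda>z. (w z)\<^sup>2)}"

definition inner_L2 :: "(real \<Rightarrow> real) \<Rightarrow> (real \<Rightarrow> real) \<Rightarrow> real" where
  "inner_L2 f g = (LINT z|leb_neg. f z * g z)"

definition norm_L2 :: "(real \<Rightarrow> real) \<Rightarrow> real" where
  "norm_L2 f = sqrt (inner_L2 f f)"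

text \<open>For \<open>w\<close> merely in \<open>L\<^sup>2\<close>, the differential expression \<open>Hw\<close> is a distribution on
  \<open>(-\<infinity>,0)\<close>: a functional on \<open>C\<^sub>c\<^sup>\<infinity>(-\<infinity>,0)\<close>. Test functions vanish near \<open>0\<close>, so no boundary
  condition at \<open>0\<close> is encoded. Continuity of the functionals plays no role below.\<close>

definition test_functions :: "(real \<Rightarrow> real) set" where
  "test_functions = {\<phi>. (\<forall>n. (deriv ^^ n) \<phi> differentiable_on UNIV) \<and>
     compact (closure {x. \<phi> x \<noteq> 0}) \<and> closure {x. \<phi> x \<noteq> 0} \<subseteq> {..<0}}"

type_synonym distr = "(real \<Rightarrow> real) \<Rightarrow> real"

definition distr_of :: "(real \<Rightarrow> real) \<Rightarrow> distr" where
  "distr_of w = (\<lambda>\<phi>. LINT z|leb_neg. w z * \<phi> z)"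

definition distr_deriv :: "distr \<Rightarrow> distr" where
  "distr_deriv T = (\<lambda>\<phi>. - T (deriv \<phi>))"

definition distr_mult :: "(real \<Rightarrow> real) \<Rightarrow> distr \<Rightarrow> distr" where
  "distr_mult a T = (\<lambda>\<phi>. T (\<lambda>z. a z * \<phi> z))"

definition H_distr :: "distr \<Rightarrow> distr" where
  "H_distr T = (\<lambda>\<phi>.
     - distr_mult (\<lambda>z. z) (distr_deriv (distr_deriv T)) \<phi>
     - 3 * distr_deriv T \<phi>
     + 1 / 4 * distr_deriv (distr_mult (\<lambda>z. z\<^sup>2) T) \<phi>)"

definition represents_H :: "(real \<Rightarrow> real) \<Rightarrow> (real \<Rightarrow> real) \<Rightarrow> bool" where
  "represents_H w f \<longleftrightarrow> f \<in> L2_neg \<and> (\<forall>\<phi>\<in>test_functions. H_distr (distr_of w) \<phi> = distr_of f \<phi>)"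

definition Dom_H :: "(real \<Rightarrow> real) set" where
  "Dom_H = {w \<in> L2_neg. \<exists>f. represents_H w f}"

text \<open>The function representing the distribution \<open>Hw\<close> is unique up to null sets, so the choice
  is harmless.\<close>

definition H_op :: "(real \<Rightarrow> real) \<Rightarrow> (real \<Rightarrow> real)" where
  "H_op w = (SOME f. represents_H w f)"

text \<open>\<open>w(0)\<close> and \<open>\<partial>\<^sub>z w\<close> only make sense for the representative of \<open>w\<close> that is continuous up to
  the boundary. Its values on \<open>{..0}\<close>, and hence its derivative on \<open>{..<0}\<close>, are determined by
  the class of \<open>w\<close>.\<close>

definition regular_representative :: "(real \<Rightarrow> real) \<Rightarrow> (real \<Rightarrow> real) \<Rightarrow> bool" where
  "regular_representative w u \<longleftrightarrow>
     (AE z in leb_neg. u z = w z) \<and> continuous_on {..0} u \<and> u differentiable_on {..<0}"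

end

theory Submission
  imports Defs "HOL-Computational_Algebra.Polynomial" "HOL-Real_Asymp.Real_Asymp"
begin

text \<open>The operator is an exact derivative, \<open>Hw = - (z w' + 2 w - z\<^sup>2 w / 4)'\<close>. If \<open>F\<close> is the
  primitive of \<open>Hw\<close> with \<open>F(0) = 0\<close>, the lemma of du Bois-Reymond thus gives a constant \<open>c\<close> with
  \<open>z w' + 2 w - z\<^sup>2 w / 4 = - G\<close> for \<open>G = F - c\<close>, that is \<open>h' = - z exp (- z\<^sup>2 / 8) G\<close> for
  \<open>h = z\<^sup>2 exp (- z\<^sup>2 / 8) w\<close>. Square integrability of \<open>w\<close> excludes the solutions of the homogeneous
  equation: it forces \<open>h\<close> to tend to zero at both ends. Comparing \<open>h\<close> with explicit barriers
  gives \<open>w(z) \<rightarrow> - G(0) / 2\<close> at \<open>0\<close> and \<open>w = O(\<bar>z\<bar> powr (- 3 / 2))\<close> at \<open>- \<infinity>\<close>. Integrating \<open>(Hw) w\<close> by parts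
  over a compact interval leaves the boundary terms of \<open>G w + w\<^sup>2 - z\<^sup>2 w\<^sup>2 / 8\<close>, whose limits
  are \<open>- w(0)\<^sup>2\<close> and \<open>0\<close>, and monotone convergence applies because the energy density is nonpositive.
  The inequality follows from
  \<open>z (w')\<^sup>2 + z w\<^sup>2 / 4 = (z w\<^sup>2 / 2)' - w\<^sup>2 / 2 + z (w' - w / 2)\<^sup>2\<close>.\<close>

section \<open>Smooth functions\<close>

text \<open>The leading coefficient of the operator vanishes at 0, and this degeneracy takes the
  place of a boundary condition. The homogeneous first-order equation is solved by
  \<open>exp (z^2 / 8) / z^2\<close>, which is square integrable neither near 0 nor near minus
  infinity; in terms of \<open>h\<close> its multiples are the constants. A solution with a limit at
  0 has to satisfy \<open>2 w(0) = - G(0)\<close>, so \<open>G w + w^2\<close> tends to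
  \<open>- 2 w(0)^2 + w(0)^2\<close>; this is where the sign and the coefficient of the boundary
  term come from. The obstacle is low regularity: \<open>Hw\<close> is only square integrable, so
  \<open>w'\<close> need not be differentiable and the second-order equation need not hold
  pointwise. The work is therefore done on the first-order equation, whose right-hand side is
  continuous up to 0, together with an integration by parts for primitives of merely integrable
  functions. Nor is \<open>z (w')^2\<close> known to be integrable beforehand; this comes out of the
  limit together with its integral.\<close>

definition smooth :: "(real \<Rightarrow> real) set" where
  "smooth = {f. \<forall>n. (deriv ^^ n) f differentiable_on UNIV}"

text \<open>Iterated derivatives never leave a set closed under \<open>deriv\<close>. Smoothness
  thus reduces to guessing a family stable under one differentiation, without a formula for the n-th
  derivative.\<close>

lemma smooth_coinduct:
  assumes "f \<in> S" and "\<And>g. g \<in> S \<Longrightarrow> g differentiable_on UNIV \<and> deriv g \<in> S"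
  shows "f \<in> smooth"
proof -
  have "(deriv ^^ n) f \<in> S" for n
    using assms by (induction n) auto
  then show ?thesis
    using assms(2) by (auto simp: smooth_def)
qed

lemma smooth_coinduct':
  assumes "f \<in> S" and "\<And>g. g \<in> S \<Longrightarrow> \<exists>g'\<in>S. \<forall>x. (g has_real_derivative g' x) (at x)"
  shows "f \<in> smooth"
proof (rule smooth_coinduct[OF assms(1)])
  fix g assume "g \<in> S"
  then obtain g' where g': "g' \<in> S" "\<And>x. (g has_real_derivative g' x) (at x)"
    using assms(2) by blast
  then have "deriv g = g'"
    by (auto intro: DERIV_imp_deriv)
  then show "g differentiable_on UNIV \<and> deriv g \<in> S"
    using g' by (auto simp: differentiable_on_def real_differentiable_def)
qed

lemma smooth_deriv: "f \<in> smooth \<Longrightarrow> deriv f \<in> smooth"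
  unfolding smooth_def mem_Collect_eq by (metis funpow_Suc_right o_apply)

lemma smooth_DERIV: "f \<in> smooth \<Longrightarrow> (f has_real_derivative deriv f x) (at x)"
  unfolding smooth_def mem_Collect_eq
  by (metis DERIV_deriv_iff_real_differentiable UNIV_I differentiable_on_def funpow_0)

lemma smooth_isCont: "f \<in> smooth \<Longrightarrow> isCont f x"
  using DERIV_isCont smooth_DERIV by blast

lemma smooth_continuous_on: "f \<in> smooth \<Longrightarrow> continuous_on S f"
  by (simp add: continuous_at_imp_continuous_on smooth_isCont)

lemma smooth_antideriv:
  assumes "\<And>x. (f has_real_derivative g x) (at x)" "g \<in> smooth"
  shows "f \<in> smooth"
  by (rule smooth_coinduct'[of _ "insert f smooth"]) (use assms smooth_DERIV smooth_deriv in blast)+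

text \<open>The Leibniz rule turns a product into a sum of products, so the products of smooth
  functions are not visibly stable under differentiation; the algebra they generate is.\<close>

inductive_set smooth_alg :: "(real \<Rightarrow> real) set" where
  base: "f \<in> smooth \<Longrightarrow> f \<in> smooth_alg"
| add: "f \<in> smooth_alg \<Longrightarrow> g \<in> smooth_alg \<Longrightarrow> (\<lambda>x. f x + g x) \<in> smooth_alg"
| mult: "f \<in> smooth_alg \<Longrightarrow> g \<in> smooth_alg \<Longrightarrow> (\<lambda>x. f x * g x) \<in> smooth_alg"

lemma smooth_alg_DERIV:
  "f \<in> smooth_alg \<Longrightarrow> \<exists>f'\<in>smooth_alg. \<forall>x. (f has_real_derivative f' x) (at x)"
proof (induction rule: smooth_alg.induct)
  case (base f)
  then show ?case
    using smooth_DERIV smooth_deriv smooth_alg.base by blast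
next
  case (add f g)
  then obtain f' g' where *: "f' \<in> smooth_alg" "g' \<in> smooth_alg"
    "\<forall>x. (f has_real_derivative f' x) (at x)" "\<forall>x. (g has_real_derivative g' x) (at x)" by blast
  then show ?case
    by (intro bexI[of _ "\<lambda>x. f' x + g' x"]) (auto intro: DERIV_add smooth_alg.add)
next
  case (mult f g)
  then obtain f' g' where *: "f' \<in> smooth_alg" "g' \<in> smooth_alg"
    "\<forall>x. (f has_real_derivative f' x) (at x)" "\<forall>x. (g has_real_derivative g' x) (at x)" by blast
  then show ?case
    by (intro bexI[of _ "\<lambda>x. f' x * g x + g' x * f x"])
      (auto intro!: DERIV_mult smooth_alg.add smooth_alg.mult mult.hyps)
qed

lemma smooth_add: "f \<in> smooth \<Longrightarrow> g \<in> smooth \<Longrightarrow> (\<lambda>x. f x + g x) \<in> smooth"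
  by (rule smooth_coinduct'[of _ smooth_alg]) (auto intro: smooth_alg.intros smooth_alg_DERIV)

lemma smooth_mult: "f \<in> smooth \<Longrightarrow> g \<in> smooth \<Longrightarrow> (\<lambda>x. f x * g x) \<in> smooth"
  by (rule smooth_coinduct'[of _ smooth_alg]) (auto intro: smooth_alg.intros smooth_alg_DERIV)

lemma smooth_const: "(\<lambda>x. c) \<in> smooth"
  by (rule smooth_coinduct'[of _ "range (\<lambda>c x. c)"]) (auto intro!: exI[of _ 0])

lemma smooth_id: "(\<lambda>x. x) \<in> smooth"
  by (rule smooth_antideriv[OF _ smooth_const[of 1]]) auto

lemma smooth_affine:
  assumes "f \<in> smooth" shows "(\<lambda>x. f (a * x + b)) \<in> smooth"
\<comment> \<open>The free factor \<open>c\<close> absorbs the powers of \<open>a\<close> that the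
  chain rule produces.\<close>
proof (rule smooth_coinduct'[of _ "{\<lambda>x. c * g (a * x + b) |c g. g \<in> smooth}"])
  show "(\<lambda>x. f (a * x + b)) \<in> {\<lambda>x. c * g (a * x + b) |c g. g \<in> smooth}"
    using assms by (auto intro!: exI[of _ 1] exI[of _ f])
next
  fix h assume "h \<in> {\<lambda>x. c * g (a * x + b) |c g. g \<in> smooth}"
  then obtain c g where h: "h = (\<lambda>x. c * g (a * x + b))" and g: "g \<in> smooth"
    by blast
  have "(h has_real_derivative (c * a) * deriv g (a * x + b)) (at x)" for x
    unfolding h by (auto intro!: derivative_eq_intros DERIV_chain2[OF smooth_DERIV[OF g]])
  then show "\<exists>h'\<in>{\<lambda>x. c * g (a * x + b) |c g. g \<in> smooth}. \<forall>x. (h has_real_derivative h' x) (at x)"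
    using smooth_deriv[OF g]
    by (intro bexI[of _ "\<lambda>x. (c * a) * deriv g (a * x + b)"]) blast+
qed

text \<open>The stable family consists of polynomials times the Gaussian: differentiation sends
  \<open>p\<close> to \<open>p' - z p / 4\<close>.\<close>

lemma smooth_gauss: "(\<lambda>z::real. exp (- z\<^sup>2 / 8)) \<in> smooth"
proof (rule smooth_coinduct'[of _ "{\<lambda>z::real. poly p z * exp (- z\<^sup>2 / 8) |p. True}"])
  show "(\<lambda>z::real. exp (- z\<^sup>2 / 8)) \<in> {\<lambda>z. poly p z * exp (- z\<^sup>2 / 8) |p. True}"
    by (auto intro!: exI[of _ "1 :: real poly"])
next
  fix g :: "real \<Rightarrow> real" assume "g \<in> {\<lambda>z. poly p z * exp (- z\<^sup>2 / 8) |p. True}"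
  then obtain p where g: "g = (\<lambda>z. poly p z * exp (- z\<^sup>2 / 8))" by blast
  have "(g has_real_derivative poly (pderiv p + [:0, -1/4:] * p) z * exp (- z\<^sup>2 / 8)) (at z)" for z
    unfolding g by (rule derivative_eq_intros poly_DERIV refl | simp add: algebra_simps)+
  then show "\<exists>g'\<in>{\<lambda>z. poly p z * exp (- z\<^sup>2 / 8) |p. True}. \<forall>x. (g has_real_derivative g' x) (at x)"
    by (intro bexI[of _ "\<lambda>z. poly (pderiv p + [:0, -1/4:] * p) z * exp (- z\<^sup>2 / 8)"]) blast+
qed

section \<open>Smooth functions that vanish to infinite order at the origin\<close>

definition flat :: "real \<Rightarrow> real poly \<Rightarrow> real \<Rightarrow> real" where
  "flat c p x = (if x > 0 then poly p (1 / x) * exp (- c / x) else 0)"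

text \<open>Half of the exponential pays for the additional factor \<open>y\<close>, the other half
  is left to the induction hypothesis; hence the induction over arbitrary \<open>c\<close>.\<close>

lemma poly_times_exp_tendsto_0:
  fixes c :: real
  assumes "c > 0" shows "((\<lambda>y. poly p y * exp (- c * y)) \<longlongrightarrow> 0) at_top"
  using assms
proof (induction p arbitrary: c)
  case 0
  then show ?case by simp
next
  case (pCons a p)
  have 1: "((\<lambda>y. a * exp (- c * y)) \<longlongrightarrow> 0) at_top"
    using \<open>c > 0\<close> by real_asymp
  have 2: "((\<lambda>y. y * exp (- (c / 2) * y)) \<longlongrightarrow> 0) at_top"
    using \<open>c > 0\<close> by real_asymp
  have "((\<lambda>y. a * exp (- c * y) + (y * exp (- (c / 2) * y)) * (poly p y * exp (- (c / 2) * y)))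
      \<longlongrightarrow> 0 + 0 * 0) at_top"
    using pCons by (intro tendsto_add tendsto_mult 1 2 pCons.IH) auto
  moreover have "a * exp (- c * y) + (y * exp (- (c / 2) * y)) * (poly p y * exp (- (c / 2) * y))
      = poly (pCons a p) y * exp (- c * y)" for y
  proof -
    have "exp (- (c / 2) * y) * exp (- (c / 2) * y) = exp (- c * y)"
      by (simp flip: exp_add)
    then show ?thesis
      by (simp add: algebra_simps)
  qed
  ultimately show ?case by simp
qed

text \<open>In the variable \<open>y = 1 / x\<close> differentiation is \<open>- y^2 d/dy\<close>,
  which sends \<open>p(y) exp (- c y)\<close> to \<open>y^2 (c p - p') exp (- c y)\<close>; this
  explains the polynomial in the conclusion. At the origin the difference quotient belongs to the
  family again, with \<open>pCons 0 p\<close> in place of \<open>p\<close>.\<close>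

lemma flat_DERIV:
  assumes "c > 0"
  shows "(flat c p has_real_derivative flat c ([:0, 0, 1:] * (smult c p - pderiv p)) x) (at x)"
proof (cases x "0 :: real" rule: linorder_cases)
  case less
  then have "eventually (\<lambda>y. flat c p y = 0) (nhds x)"
    by (intro eventually_nhds_in_open[THEN eventually_mono, of "{..<0}"]) (auto simp: flat_def)
  then show ?thesis
    using less by (subst DERIV_cong_ev[OF refl _ refl]) (auto simp: flat_def)
next
  case greater
  then have "eventually (\<lambda>y. flat c p y = poly p (1 / y) * exp (- c / y)) (nhds x)"
    by (intro eventually_nhds_in_open[THEN eventually_mono, of "{0<..}"]) (auto simp: flat_def)
  moreover have "((\<lambda>y. poly p (1 / y) * exp (- c / y)) has_real_derivative
      flat c ([:0, 0, 1:] * (smult c p - pderiv p)) x) (at x)"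
    using greater unfolding flat_def
    by (auto intro!: derivative_eq_intros DERIV_chain2[OF poly_DERIV]
        simp: field_simps power2_eq_square)
  ultimately show ?thesis
    by (subst DERIV_cong_ev[OF refl _ refl])
next
  case equal
  have "((\<lambda>h. flat c p h / h) \<longlongrightarrow> 0) (at_right 0)"
  proof -
    have "((\<lambda>h. poly (pCons 0 p) (inverse h) * exp (- c * inverse h)) \<longlongrightarrow> 0) (at_right 0)"
      by (rule filterlim_compose[OF poly_times_exp_tendsto_0[OF assms] filterlim_inverse_at_top_right])
    moreover have "eventually (\<lambda>h. poly (pCons 0 p) (inverse h) * exp (- c * inverse h) = flat c p h / h)
        (at_right 0)"
      by (intro eventually_at_rightI[of 0 1]) (auto simp: flat_def divide_inverse)
    ultimately show ?thesis
      using tendsto_cong by force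
  qed
  moreover have "((\<lambda>h. flat c p h / h) \<longlongrightarrow> 0) (at_left 0)"
    by (rule tendsto_eventually) (auto intro!: eventually_at_leftI[of "-1"] simp: flat_def)
  ultimately have "((\<lambda>h. flat c p h / h) \<longlongrightarrow> 0) (at 0)"
    by (simp add: filterlim_at_split)
  then show ?thesis
    using equal by (simp add: DERIV_def flat_def)
qed

lemma smooth_flat: "c > 0 \<Longrightarrow> flat c p \<in> smooth"
  by (rule smooth_coinduct'[of _ "range (flat c)"]) (auto intro!: flat_DERIV)

section \<open>Test functions and the lemma of du Bois-Reymond\<close>

lemma integral_support:
  fixes g :: "'a::euclidean_space \<Rightarrow> 'b::euclidean_space"
  assumes "\<And>x. x \<notin> S \<Longrightarrow> g x = 0" "S \<subseteq> T"
  shows "integral T g = integral S g"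
proof -
  have "(\<lambda>x. if x \<in> T then g x else 0) = g" "(\<lambda>x. if x \<in> S then g x else 0) = g"
    using assms by (auto simp: fun_eq_iff)
  then show ?thesis
    using integral_restrict_UNIV[of T g] integral_restrict_UNIV[of S g] by simp
qed

text \<open>A nonempty compact support attains its extrema \<open>r\<close> and \<open>s\<close>,
  and \<open>s\<close> is negative. The enclosing interval is widened on the right to
  \<open>s / 2\<close> instead of a shift of \<open>s\<close>, because it must stay away from
  0.\<close>

lemma test_functions_iff:
  "\<phi> \<in> test_functions \<longleftrightarrow>
    \<phi> \<in> smooth \<and> (\<exists>a b. a < b \<and> b < 0 \<and> (\<forall>x. x \<notin> {a<..<b} \<longrightarrow> \<phi> x = 0))"
proof
  assume \<phi>: "\<phi> \<in> test_functions"
  define K where "K = closure {x. \<phi> x \<noteq> 0}"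
  have K: "compact K" "K \<subseteq> {..<0}" and "{x. \<phi> x \<noteq> 0} \<subseteq> K"
    using \<phi> by (auto simp: test_functions_def K_def closure_subset)
  then have zero: "\<phi> x = 0" if "x \<notin> K" for x
    using that by auto
  have "\<exists>a b. a < b \<and> b < 0 \<and> (\<forall>x. x \<notin> {a<..<b} \<longrightarrow> \<phi> x = 0)"
  proof (cases "K = {}")
    case True
    then show ?thesis using zero by (intro exI[of _ "-2"] exI[of _ "-1"]) auto
  next
    case False
    obtain s where s: "s \<in> K" "\<And>x. x \<in> K \<Longrightarrow> x \<le> s"
      using compact_attains_sup[OF K(1) False] by blast
    obtain r where r: "r \<in> K" "\<And>x. x \<in> K \<Longrightarrow> r \<le> x"
      using compact_attains_inf[OF K(1) False] by blast
    have "r \<le> s" "s < 0"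
      using s r K by auto
    moreover have "x \<in> {r - 1<..<s / 2}" if "\<phi> x \<noteq> 0" for x
      using s(2)[of x] r(2)[of x] \<open>s < 0\<close> that zero by fastforce
    ultimately show ?thesis
      by (intro exI[of _ "r - 1"] exI[of _ "s / 2"]) auto
  qed
  then show "\<phi> \<in> smooth \<and> (\<exists>a b. a < b \<and> b < 0 \<and> (\<forall>x. x \<notin> {a<..<b} \<longrightarrow> \<phi> x = 0))"
    using \<phi> by (simp add: test_functions_def smooth_def)
next
  assume "\<phi> \<in> smooth \<and> (\<exists>a b. a < b \<and> b < 0 \<and> (\<forall>x. x \<notin> {a<..<b} \<longrightarrow> \<phi> x = 0))"
  then obtain a b where \<phi>: "\<phi> \<in> smooth" and ab: "b < 0" "\<And>x. x \<notin> {a<..<b} \<Longrightarrow> \<phi> x = 0"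
    by blast
  have "closure {x. \<phi> x \<noteq> 0} \<subseteq> {a..b}"
  proof (rule closure_minimal[OF subsetI closed_atLeastAtMost])
    show "x \<in> {a..b}" if "x \<in> {x. \<phi> x \<noteq> 0}" for x
      using ab(2)[of x] that by fastforce
  qed
  then show "\<phi> \<in> test_functions"
    using \<phi> ab(1) compact_Int_closed[OF compact_Icc[of a b] closed_closure[of "{x. \<phi> x \<noteq> 0}"]]
    by (auto simp: test_functions_def smooth_def Int_absorb1)
qed

lemma test_smooth: "\<phi> \<in> test_functions \<Longrightarrow> \<phi> \<in> smooth"
  by (simp add: test_functions_iff)

lemma test_support:
  assumes "\<phi> \<in> test_functions"
  obtains a b where "a < b" "b < 0" "\<And>x. x \<notin> {a<..<b} \<Longrightarrow> \<phi> x = 0"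
  using assms by (auto simp: test_functions_iff)

lemma test_functionsI:
  assumes "\<phi> \<in> smooth" "\<psi> \<in> test_functions" "\<And>x. \<psi> x = 0 \<Longrightarrow> \<phi> x = 0"
  shows "\<phi> \<in> test_functions"
  using assms unfolding test_functions_iff by metis

lemma test_mult: "f \<in> smooth \<Longrightarrow> \<phi> \<in> test_functions \<Longrightarrow> (\<lambda>x. f x * \<phi> x) \<in> test_functions"
  by (rule test_functionsI[of _ \<phi>]) (simp_all add: smooth_mult test_smooth)

lemma test_diff_scaled:
  assumes \<psi>: "\<psi> \<in> test_functions" and \<eta>: "\<eta> \<in> test_functions"
  shows "(\<lambda>x. \<psi> x - c * \<eta> x) \<in> test_functions"
proof -
  obtain a b where ab: "a < b" "b < 0" "\<And>x. x \<notin> {a<..<b} \<Longrightarrow> \<psi> x = 0"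
    using test_support[OF \<psi>] by metis
  obtain a' b' where ab': "a' < b'" "b' < 0" "\<And>x. x \<notin> {a'<..<b'} \<Longrightarrow> \<eta> x = 0"
    using test_support[OF \<eta>] by metis
  have "(\<lambda>x. \<psi> x + (- c) * \<eta> x) \<in> smooth"
    by (intro smooth_add smooth_mult smooth_const test_smooth \<psi> \<eta>)
  moreover have "\<psi> x - c * \<eta> x = 0" if "x \<notin> {min a a'<..<max b b'}" for x
  proof -
    have "x \<notin> {a<..<b}" "x \<notin> {a'<..<b'}"
      using that by auto
    then show ?thesis
      using ab(3) ab'(3) by simp
  qed
  moreover have "min a a' < max b b'" "max b b' < 0"
    using ab ab' by auto
  ultimately show ?thesis
    unfolding test_functions_iff by (simp only: diff_conv_add_uminus mult_minus_left) blast
qed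

lemma deriv_zero_outside:
  fixes \<phi> :: "real \<Rightarrow> real"
  assumes "\<And>x. x \<notin> {a<..<b} \<Longrightarrow> \<phi> x = 0" "x < a \<or> b < x"
  shows "deriv \<phi> x = 0"
proof -
  have "eventually (\<lambda>y. \<phi> y = 0) (nhds x)"
    using assms by (intro eventually_nhds_in_open[THEN eventually_mono, of "- {a..b}"]) auto
  then have "deriv \<phi> x = deriv (\<lambda>y. 0) x"
    by (rule deriv_cong_ev) simp
  then show ?thesis by simp
qed

lemma test_deriv:
  assumes "\<phi> \<in> test_functions" shows "deriv \<phi> \<in> test_functions"
proof -
  obtain a b where ab: "a < b" "b < 0" "\<And>x. x \<notin> {a<..<b} \<Longrightarrow> \<phi> x = 0"
    using test_support[OF assms] by metis
  \<comment> \<open>\<open>deriv_zero_outside\<close> says nothing about the endpoints, hence the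
    slightly wider interval.\<close>
  have "deriv \<phi> x = 0" if "x \<notin> {a - 1<..<b / 2}" for x
    by (rule deriv_zero_outside[OF ab(3)]) (use ab that in auto)
  moreover have "a - 1 < b / 2" "b / 2 < 0"
    using ab by auto
  ultimately show ?thesis
    using smooth_deriv[OF test_smooth[OF assms]] unfolding test_functions_iff by blast
qed

text \<open>The primitive that starts left of the support is constant to the right of it, and this
  constant is the total integral, that is 0.\<close>

lemma test_antideriv:
  assumes \<psi>: "\<psi> \<in> test_functions" and "integral {..<0} \<psi> = 0"
  shows "\<exists>\<phi>\<in>test_functions. deriv \<phi> = \<psi>"
proof -
  obtain a b where ab: "a < b" "b < 0" "\<And>x. x \<notin> {a<..<b} \<Longrightarrow> \<psi> x = 0"
    using test_support[OF \<psi>] by metis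
  \<comment> \<open>Starting at \<open>a - 1\<close> makes every \<open>x \<ge> a\<close> an
    interior point of the interval of integration, so that the derivative there is
    two-sided.\<close>
  define \<phi> where "\<phi> x = integral {a - 1..x} \<psi>" for x
  have left: "\<phi> x = 0" if "x \<le> a" for x
    unfolding \<phi>_def using ab that
    by (subst integral_cong[of _ _ "\<lambda>_. 0"]) auto
  have right: "\<phi> x = 0" if "x \<ge> b" for x
  proof -
    have "\<phi> x = integral {a<..<b} \<psi>"
      unfolding \<phi>_def by (rule integral_support) (use ab that in auto)
    also have "\<dots> = integral {..<0} \<psi>"
      by (rule integral_support[symmetric]) (use ab in auto)
    finally show ?thesis using assms by simp
  qed
  have D: "(\<phi> has_real_derivative \<psi> x) (at x)" for x
  proof (cases "x < a")
    case True
    then have "eventually (\<lambda>y. \<phi> y = 0) (nhds x)"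
      using left by (intro eventually_nhds_in_open[THEN eventually_mono, of "{..<a}"]) auto
    then show ?thesis
      using True ab by (subst DERIV_cong_ev[OF refl _ refl]) auto
  next
    case False
    have "((\<lambda>u. integral {a - 1..u} \<psi>) has_real_derivative \<psi> x) (at x within {a - 1..x + 1})"
      using False by (intro integral_has_real_derivative smooth_continuous_on test_smooth \<psi>) auto
    then show ?thesis
      using False by (simp add: \<phi>_def[abs_def] at_within_Icc_at)
  qed
  have "\<phi> \<in> smooth"
    by (rule smooth_antideriv[OF D test_smooth[OF \<psi>]])
  moreover have "\<phi> x = 0" if "x \<notin> {a<..<b}" for x
    using left right that by force
  ultimately have "\<phi> \<in> test_functions"
    using ab by (auto simp: test_functions_iff)
  moreover have "deriv \<phi> = \<psi>"
    using D by (auto intro: DERIV_imp_deriv)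
  ultimately show ?thesis by blast
qed

text \<open>The parameter \<open>c\<close> controls the steepness: as \<open>c\<close> decreases to
  0, the bumps increase to the indicator of \<open>{a<..<b}\<close> and stay between 0 and
  1.\<close>

definition bump :: "real \<Rightarrow> real \<Rightarrow> real \<Rightarrow> real \<Rightarrow> real" where
  "bump c a b x = flat c 1 (x - a) * flat c 1 (b - x)"

lemma bump_test:
  assumes "c > 0" "a < b" "b < 0" shows "bump c a b \<in> test_functions"
proof -
  have "(\<lambda>x. flat c 1 (1 * x + (- a)) * flat c 1 (- 1 * x + b)) \<in> smooth"
    by (intro smooth_mult smooth_affine smooth_flat assms)
  then have "bump c a b \<in> smooth"
    by (simp add: bump_def[abs_def] algebra_simps)
  then show ?thesis
    using assms by (fastforce simp: test_functions_iff bump_def flat_def)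
qed

lemma bump_bounds:
  assumes "c > 0" shows "0 \<le> bump c a b x" "bump c a b x \<le> 1"
proof -
  have "0 \<le> flat c 1 y" "flat c 1 y \<le> 1" for y
    using assms by (auto simp: flat_def)
  then show "0 \<le> bump c a b x" "bump c a b x \<le> 1"
    by (auto simp: bump_def intro: mult_le_one)
qed

lemma bump_tendsto:
  "(\<lambda>n. bump (1 / real (Suc n)) a b x) \<longlonglongrightarrow> (if x \<in> {a<..<b} then 1 else 0)"
proof -
  have "(\<lambda>n. flat (1 / real (Suc n)) 1 y) \<longlonglongrightarrow> (if y > 0 then 1 else 0)" for y
  proof (cases "y > 0")
    case True
    have "(\<lambda>n. exp (- (1 / real (Suc n)) / y)) \<longlonglongrightarrow> exp (- 0 / y)"
      using True by (intro tendsto_intros LIMSEQ_Suc[OF lim_1_over_n]) auto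
    then show ?thesis
      using True by (simp add: flat_def)
  qed (simp add: flat_def)
  then have "(\<lambda>n. bump (1 / real (Suc n)) a b x) \<longlonglongrightarrow>
      (if x - a > 0 then 1 else 0) * (if b - x > 0 then 1 else 0)"
    unfolding bump_def by (intro tendsto_mult)
  then show ?thesis
    by (auto split: if_splits)
qed

section \<open>Local integrability and the fundamental lemma of the calculus of variations\<close>

definition locally_integrable_neg :: "(real \<Rightarrow> real) \<Rightarrow> bool" where
  "locally_integrable_neg k \<longleftrightarrow> (\<forall>a b. b < 0 \<longrightarrow> k absolutely_integrable_on {a..b})"

lemma mult_continuous_absolutely_integrable:
  fixes k \<phi> :: "real \<Rightarrow> real"
  assumes "k absolutely_integrable_on {a..b}" "continuous_on {a..b} \<phi>"
  shows "(\<lambda>z. k z * \<phi> z) absolutely_integrable_on {a..b}"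
proof -
  have "bounded (\<phi> ` {a..b})"
    using assms(2) by (intro compact_imp_bounded compact_continuous_image) auto
  then show ?thesis
    using absolutely_integrable_bounded_measurable_product_real[of \<phi> "{a..b}" k] assms
    by (simp add: mult.commute continuous_imp_measurable_on_sets_lebesgue)
qed

lemma locally_integrable_continuous:
  "continuous_on {..<0} k \<Longrightarrow> locally_integrable_neg k"
  unfolding locally_integrable_neg_def
  by (auto intro!: absolutely_integrable_continuous_real elim: continuous_on_subset)

lemma locally_integrable_mult_continuous:
  "locally_integrable_neg k \<Longrightarrow> continuous_on {..<0} g \<Longrightarrow> locally_integrable_neg (\<lambda>z. k z * g z)"
  unfolding locally_integrable_neg_def
  by (auto intro!: mult_continuous_absolutely_integrable elim: continuous_on_subset)

lemma locally_integrable_diff: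
  "locally_integrable_neg k \<Longrightarrow> locally_integrable_neg l \<Longrightarrow> locally_integrable_neg (\<lambda>z. k z - l z)"
  unfolding locally_integrable_neg_def by (metis set_integral_diff(1))

lemma test_mult_integrable:
  assumes "locally_integrable_neg k" "\<phi> \<in> test_functions"
  shows "(\<lambda>z. k z * \<phi> z) absolutely_integrable_on {..<0}"
proof -
  obtain a b where ab: "a < b" "b < 0" "\<And>x. x \<notin> {a<..<b} \<Longrightarrow> \<phi> x = 0"
    using test_support[OF assms(2)] by metis
  have "(\<lambda>z. k z * \<phi> z) absolutely_integrable_on {a..b}"
    using assms ab
    by (intro mult_continuous_absolutely_integrable smooth_continuous_on test_smooth)
      (auto simp: locally_integrable_neg_def)
  moreover have "(\<lambda>z. if z \<in> {a..b} then k z * \<phi> z else 0) = (\<lambda>z. if z \<in> {..<0} then k z * \<phi> z else 0)"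
    using ab by fastforce
  ultimately show ?thesis
    using absolutely_integrable_restrict_UNIV[of "{a..b}" "\<lambda>z. k z * \<phi> z"]
      absolutely_integrable_restrict_UNIV[of "{..<0}" "\<lambda>z. k z * \<phi> z"] by simp
qed

lemma test_mult_integrable_on:
  "locally_integrable_neg k \<Longrightarrow> \<phi> \<in> test_functions \<Longrightarrow> (\<lambda>z. k z * \<phi> z) integrable_on {..<0}"
  by (rule set_lebesgue_integral_eq_integral(1)[OF test_mult_integrable])

lemma test_integral_lin:
  assumes k: "locally_integrable_neg k" and t: "\<psi> \<in> test_functions" "\<eta> \<in> test_functions"
  shows "integral {..<0} (\<lambda>z. k z * (\<psi> z - c * \<eta> z))
    = integral {..<0} (\<lambda>z. k z * \<psi> z) - c * integral {..<0} (\<lambda>z. k z * \<eta> z)"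
proof -
  have "integral {..<0} (\<lambda>z. k z * (\<psi> z - c * \<eta> z))
      = integral {..<0} (\<lambda>z. k z * \<psi> z - c * (k z * \<eta> z))"
    by (simp add: algebra_simps)
  also have "\<dots> = integral {..<0} (\<lambda>z. k z * \<psi> z) - c * integral {..<0} (\<lambda>z. k z * \<eta> z)"
    using t k by (subst integral_diff)
      (auto intro!: integrable_on_mult_right test_mult_integrable_on)
  finally show ?thesis .
qed

text \<open>Bumps converge boundedly to indicators of intervals, so by dominated convergence
  \<open>k\<close> has integral zero over every compact interval. The Lebesgue differentiation
  theorem then makes \<open>k\<close> vanish almost everywhere.\<close>

lemma fundamental_lemma:
  assumes k: "locally_integrable_neg k"
    and zero: "\<And>\<phi>. \<phi> \<in> test_functions \<Longrightarrow> integral {..<0} (\<lambda>z. k z * \<phi> z) = 0"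
  shows "\<exists>N. negligible N \<and> (\<forall>z<0. z \<notin> N \<longrightarrow> k z = 0)"
proof -
  have int0: "integral {a..b} k = 0" if "b < 0" for a b
  proof (cases "a < b")
    case True
    have ki: "k absolutely_integrable_on {a..b}"
      using k that by (auto simp: locally_integrable_neg_def)
    let ?\<beta> = "\<lambda>n. bump (1 / real (Suc n)) a b"
    have test: "?\<beta> n \<in> test_functions" for n
      using True that by (intro bump_test) auto
    have "((\<lambda>x. if x \<in> {a<..<b} then k x else 0) has_integral 0) {a..b}"
    proof (rule has_integral_dominated_convergence)
      show "((\<lambda>z. k z * ?\<beta> n z) has_integral 0) {a..b}" for n
      proof -
        have "integral {a..b} (\<lambda>z. k z * ?\<beta> n z) = integral {..<0} (\<lambda>z. k z * ?\<beta> n z)"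
          by (rule integral_support[symmetric]) (use that in \<open>auto simp: bump_def flat_def\<close>)
        moreover have "(\<lambda>z. k z * ?\<beta> n z) integrable_on {a..b}"
          by (intro set_lebesgue_integral_eq_integral(1) mult_continuous_absolutely_integrable ki
              smooth_continuous_on test_smooth test)
        ultimately show ?thesis
          using zero[OF test] by (metis has_integral_integral)
      qed
      show "(\<lambda>x. \<bar>k x\<bar>) integrable_on {a..b}"
        using ki unfolding absolutely_integrable_on_def real_norm_def by simp
      show "\<forall>x\<in>{a..b}. norm (k x * ?\<beta> n x) \<le> \<bar>k x\<bar>" for n
        using bump_bounds[of "1 / real (Suc n)" a b] by (auto simp: abs_mult intro!: mult_left_le)
      show "\<forall>x\<in>{a..b}. (\<lambda>n. k x * ?\<beta> n x) \<longlonglongrightarrow> (if x \<in> {a<..<b} then k x else 0)"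
      proof
        fix x
        have "(\<lambda>n. k x * ?\<beta> n x) \<longlonglongrightarrow> k x * (if x \<in> {a<..<b} then 1 else 0)"
          by (intro tendsto_intros bump_tendsto)
        then show "(\<lambda>n. k x * ?\<beta> n x) \<longlonglongrightarrow> (if x \<in> {a<..<b} then k x else 0)"
          by (auto split: if_splits)
      qed
    qed simp
    then have "(k has_integral 0) {a..b}"
      by (rule has_integral_spike[rotated 2, of _ _ _ "{a, b}"]) auto
    then show ?thesis by (rule integral_unique)
  next
    case False
    then show ?thesis by (cases "a = b") auto
  qed
  \<comment> \<open>Local integrability gives no control at 0, so the exceptional set is built
    separately on each half-line ending at \<open>- 1 / (n + 1)\<close>; the countable union remains
    negligible.\<close>
  have "\<exists>N. negligible N \<and> (\<forall>z. z \<le> - 1 / real (Suc n) \<and> z \<notin> N \<longrightarrow> k z = 0)" for n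
  proof -
    define s where "s = - 1 / real (Suc n)"
    have s: "s < 0" by (simp add: s_def)
    \<comment> \<open>The differentiation theorem asks for integrability on all boxes of the real
      line, which the cut-off at \<open>s\<close> provides.\<close>
    define ks where "ks = (\<lambda>z. if z \<in> {..s} then k z else 0)"
    have I: "(ks has_integral 0) (cbox a b)" for a b
    proof -
      have "k absolutely_integrable_on {a..min b s}"
        using k s by (auto simp: locally_integrable_neg_def)
      then have "k integrable_on {a..min b s}"
        by (rule set_lebesgue_integral_eq_integral(1))
      then have "(k has_integral 0) {a..min b s}"
        using int0[of "min b s" a] s by (simp add: has_integral_integrable_integral)
      moreover have "{a..min b s} = {..s} \<inter> cbox a b" by auto
      ultimately show ?thesis
        by (simp only: has_integral_restrict_Int ks_def)
    qed
    \<comment> \<open>Off a negligible set \<open>ks x\<close> is the limit of its averages over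
      \<open>{x..x + h}\<close>, and these are all 0. If \<open>ks x\<close> were nonzero, the
      choice of its norm as tolerance would leave no admissible \<open>h\<close> between 0 and
      \<open>d\<close>.\<close>
    show ?thesis
    proof (rule integrable_ccontinuous_explicit[of ks, OF has_integral_integrable[OF I]])
      fix N
      assume N: "negligible N" "\<And>x e. \<lbrakk>x \<notin> N; 0 < e\<rbrakk> \<Longrightarrow> \<exists>d>0. \<forall>h. 0 < h \<and> h < d \<longrightarrow>
         norm (integral (cbox x (x + h *\<^sub>R One)) ks /\<^sub>R h ^ DIM(real) - ks x) < e"
      have "ks x = 0" if "x \<notin> N" for x
      proof (rule ccontr)
        assume "ks x \<noteq> 0"
        then have "0 < norm (ks x)" by simp
        from N(2)[OF that this] have "\<exists>d>0::real. \<forall>h. \<not> (0 < h \<and> h < d)"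
          by (simp only: integral_unique[OF I] scaleR_zero_right diff_0 norm_minus_cancel less_irrefl not_def)
        then show False
          by (metis dense)
      qed
      then show ?thesis
        using N(1) unfolding ks_def s_def by (intro exI[of _ N]) (metis atMost_iff)
    qed
  qed
  then have "\<exists>N. \<forall>n. negligible (N n) \<and> (\<forall>z. z \<le> - 1 / real (Suc n) \<and> z \<notin> N n \<longrightarrow> k z = 0)"
    by (intro choice allI)
  then obtain N where N: "\<And>n. negligible (N n)"
    "\<And>n z. z \<le> - 1 / real (Suc n) \<Longrightarrow> z \<notin> N n \<Longrightarrow> k z = 0"
    by blast
  have "k z = 0" if "z < 0" "z \<notin> (\<Union>n. N n)" for z
  proof -
    obtain n where "inverse (real (Suc n)) < - z"
      using reals_Archimedean[of "- z"] \<open>z < 0\<close> by auto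
    then show ?thesis
      using N(2)[of z n] that by (auto simp: field_simps)
  qed
  moreover have "negligible (\<Union>n. N n)"
    using N(1) by (intro negligible_countable_Union) auto
  ultimately show ?thesis by blast
qed

text \<open>Test functions of integral zero are exactly where \<open>test_antideriv\<close> applies.
  Subtracting a multiple of a fixed bump reaches integral zero, so the value of \<open>T\<close> at
  that bump determines \<open>T\<close>. This abstract form serves both du Bois-Reymond and the weak
  first-order equation.\<close>

lemma test_functional_const:
  assumes T0: "\<And>\<phi>. \<phi> \<in> test_functions \<Longrightarrow> T (deriv \<phi>) = 0"
    and lin: "\<And>\<psi> \<eta> c. \<psi> \<in> test_functions \<Longrightarrow> \<eta> \<in> test_functions \<Longrightarrow>
      T (\<lambda>x. \<psi> x - c * \<eta> x) = T \<psi> - c * T \<eta>"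
  shows "\<exists>c::real. \<forall>\<psi>\<in>test_functions. T \<psi> = c * integral {..<0} \<psi>"
proof -
  have one: "locally_integrable_neg (\<lambda>z. 1)"
    by (rule locally_integrable_continuous) auto
  have int: "\<psi> integrable_on {..<0}" if "\<psi> \<in> test_functions" for \<psi>
    using test_mult_integrable_on[OF one that] by simp
  define \<beta> where "\<beta> = bump 1 (-2) (-1)"
  have \<beta>: "\<beta> \<in> test_functions"
    unfolding \<beta>_def by (rule bump_test) auto
  \<comment> \<open>A continuous nonnegative function with integral zero vanishes, whereas
    \<open>\<beta>\<close> is positive at the midpoint \<open>- 3 / 2\<close>.\<close>
  have "integral {..<0} \<beta> \<noteq> 0"
  proof
    assume "integral {..<0} \<beta> = 0"
    moreover have "integral {..<0} \<beta> = integral {-2..-1} \<beta>"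
      by (rule integral_support) (auto simp: \<beta>_def bump_def flat_def)
    moreover have "\<beta> integrable_on {-2..-1}"
      by (intro integrable_continuous_real smooth_continuous_on test_smooth \<beta>)
    ultimately have "(\<beta> has_integral 0) (cbox (-2) (-1))"
      by (simp add: has_integral_integrable_integral)
    then have "\<beta> (- 3 / 2) = 0"
      by (rule has_integral_0_cbox_imp_0[rotated 2])
        (auto simp: \<beta>_def bump_bounds intro!: smooth_continuous_on test_smooth bump_test)
    then show False
      by (simp add: \<beta>_def bump_def flat_def)
  qed
  then have ib: "integral {..<0} \<beta> \<noteq> 0" .
  have "T \<psi> = T \<beta> / integral {..<0} \<beta> * integral {..<0} \<psi>" if \<psi>: "\<psi> \<in> test_functions" for \<psi>
  proof -
    define c where "c = integral {..<0} \<psi> / integral {..<0} \<beta>"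
    have "(\<lambda>x. \<psi> x - c * \<beta> x) \<in> test_functions"
      by (rule test_diff_scaled[OF \<psi> \<beta>])
    moreover have "integral {..<0} (\<lambda>x. \<psi> x - c * \<beta> x) = 0"
      using ib int[OF \<psi>] int[OF \<beta>]
      by (subst integral_diff) (auto simp: c_def intro!: integrable_on_mult_right)
    ultimately obtain \<phi> where "\<phi> \<in> test_functions" "deriv \<phi> = (\<lambda>x. \<psi> x - c * \<beta> x)"
      using test_antideriv by blast
    then have "T \<psi> - c * T \<beta> = 0"
      using T0[of \<phi>] lin[OF \<psi> \<beta>, of c] by simp
    then show ?thesis
      by (simp add: c_def)
  qed
  then show ?thesis by blast
qed

lemma du_Bois_Reymond:
  assumes k: "locally_integrable_neg k"
    and zero: "\<And>\<phi>. \<phi> \<in> test_functions \<Longrightarrow> integral {..<0} (\<lambda>z. k z * deriv \<phi> z) = 0"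
  shows "\<exists>c N. negligible N \<and> (\<forall>z<0. z \<notin> N \<longrightarrow> k z = c)"
proof -
  have const: "locally_integrable_neg (\<lambda>z. c)" for c
    by (rule locally_integrable_continuous) auto
  have "\<exists>c. \<forall>\<psi>\<in>test_functions. integral {..<0} (\<lambda>z. k z * \<psi> z) = c * integral {..<0} \<psi>"
  proof (rule test_functional_const[where T = "\<lambda>\<psi>. integral {..<0} (\<lambda>z. k z * \<psi> z)", OF zero])
    fix \<psi> \<eta> :: "real \<Rightarrow> real" and c :: real
    assume t: "\<psi> \<in> test_functions" "\<eta> \<in> test_functions"
    show "integral {..<0} (\<lambda>z. k z * (\<psi> z - c * \<eta> z)) =
        integral {..<0} (\<lambda>z. k z * \<psi> z) - c * integral {..<0} (\<lambda>z. k z * \<eta> z)"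
      by (rule test_integral_lin[OF k t])
  qed
  then obtain c where c: "\<And>\<psi>. \<psi> \<in> test_functions \<Longrightarrow>
      integral {..<0} (\<lambda>z. k z * \<psi> z) = c * integral {..<0} \<psi>"
    by blast
  have "\<exists>N. negligible N \<and> (\<forall>z<0. z \<notin> N \<longrightarrow> k z - c = 0)"
  proof (rule fundamental_lemma[OF locally_integrable_diff[OF k const]])
    fix \<phi> assume \<phi>: "\<phi> \<in> test_functions"
    have "integral {..<0} (\<lambda>z. k z * \<phi> z - c * \<phi> z) = 0"
      using test_mult_integrable_on[OF k \<phi>] test_mult_integrable_on[OF const[of c] \<phi>] c[OF \<phi>]
      by (subst integral_diff) auto
    then show "integral {..<0} (\<lambda>z. (k z - c) * \<phi> z) = 0"
      by (simp add: algebra_simps)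
  qed
  then show ?thesis by auto
qed

section \<open>Primitives of square integrable functions\<close>

lemma absolutely_integrable_imp_integrable_on:
  fixes f :: "'a::euclidean_space \<Rightarrow> 'b::euclidean_space"
  shows "f absolutely_integrable_on S \<Longrightarrow> f integrable_on S"
  by (simp add: absolutely_integrable_on_def)

lemma abs_integral_le:
  fixes f g :: "real \<Rightarrow> real"
  assumes "f integrable_on S" "g integrable_on S" "\<And>x. x \<in> S \<Longrightarrow> \<bar>f x\<bar> \<le> g x"
  shows "\<bar>integral S f\<bar> \<le> integral S g"
  using Henstock_Kurzweil_Integration.integral_norm_bound_integral[of f S g] assms by simp

text \<open>Absolute continuity expressed through increments: no pointwise derivative of
  \<open>F\<close> is mentioned, and the additive constant stays free, which later allows passing
  from \<open>F\<close> to \<open>G = F - c\<close>.\<close>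

definition primitive_on :: "real set \<Rightarrow> (real \<Rightarrow> real) \<Rightarrow> (real \<Rightarrow> real) \<Rightarrow> bool" where
  "primitive_on S f F \<longleftrightarrow> (\<forall>a b. a \<le> b \<longrightarrow> {a..b} \<subseteq> S \<longrightarrow>
     f absolutely_integrable_on {a..b} \<and> integral {a..b} f = F b - F a)"

lemma primitive_onD:
  assumes "primitive_on S f F" "a \<le> b" "{a..b} \<subseteq> S"
  shows "f absolutely_integrable_on {a..b}" "integral {a..b} f = F b - F a"
  using assms unfolding primitive_on_def by blast+

lemma primitive_on_subset: "primitive_on S f F \<Longrightarrow> T \<subseteq> S \<Longrightarrow> primitive_on T f F"
  unfolding primitive_on_def by (meson order_trans)

lemma primitive_on_diff_const: "primitive_on S f F \<Longrightarrow> primitive_on S f (\<lambda>x. F x - c)"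
  by (simp add: primitive_on_def)

lemma primitive_on_continuous:
  assumes "primitive_on S f F" "{a..b} \<subseteq> S"
  shows "continuous_on {a..b} F"
proof (cases "a \<le> b")
  case True
  have "continuous_on {a..b} (\<lambda>x. F a + integral {a..x} f)"
    using primitive_onD(1)[OF assms(1) True assms(2)]
    by (intro continuous_intros indefinite_integral_continuous_1 absolutely_integrable_imp_integrable_on)
  moreover have "F a + integral {a..x} f = F x" if "x \<in> {a..b}" for x
    using primitive_onD(2)[OF assms(1), of a x] assms(2) that by fastforce
  ultimately show ?thesis
    using continuous_on_cong[of "{a..b}" "{a..b}" F "\<lambda>x. F a + integral {a..x} f"] by metis
qed simp

lemma primitive_on_DERIV:
  fixes F g :: "real \<Rightarrow> real"
  assumes "\<And>x. x \<in> S \<Longrightarrow> (F has_real_derivative g x) (at x)" "continuous_on S g"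
  shows "primitive_on S g F"
  unfolding primitive_on_def
proof (intro allI impI conjI)
  fix a b :: real assume ab: "a \<le> b" "{a..b} \<subseteq> S"
  then show "g absolutely_integrable_on {a..b}"
    using assms(2) by (intro absolutely_integrable_continuous_real) (rule continuous_on_subset)
  have "(g has_integral F b - F a) {a..b}"
  proof (rule fundamental_theorem_of_calculus[OF ab(1)])
    fix x assume "x \<in> {a..b}"
    then have "(F has_real_derivative g x) (at x within {a..b})"
      using assms(1) ab(2) has_field_derivative_at_within by blast
    then show "(F has_vector_derivative g x) (at x within {a..b})"
      by (simp add: has_real_derivative_iff_has_vector_derivative)
  qed
  then show "integral {a..b} g = F b - F a"
    by (rule integral_unique)
qed

text \<open>The function \<open>f\<close> is merely integrable, so \<open>F\<close> need not be differentiable everywhere. The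
  difference of the two sides, as a function of the upper endpoint, changes over \<open>{x..y}\<close> by at
  most a multiple of \<open>(y - x) * (\<integral>\<bar>f\<bar>)\<close> and therefore has derivative zero.\<close>

lemma primitive_by_parts:
  fixes f F g g' :: "real \<Rightarrow> real"
  assumes "a \<le> b" and F: "primitive_on {a..b} f F"
    and g: "\<And>x. x \<in> {a..b} \<Longrightarrow> (g has_real_derivative g' x) (at x within {a..b})"
    and g': "continuous_on {a..b} g'"
  shows "integral {a..b} (\<lambda>x. f x * g x) = F b * g b - F a * g a - integral {a..b} (\<lambda>x. F x * g' x)"
proof -
  have f: "f absolutely_integrable_on {a..b}"
    using primitive_onD(1)[OF F] \<open>a \<le> b\<close> by blast
  have contF: "continuous_on {a..b} F"
    using primitive_on_continuous[OF F] by blast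
  have contg: "continuous_on {a..b} g"
    by (rule DERIV_continuous_on[OF g])
  have fg: "(\<lambda>x. f x * g x) absolutely_integrable_on {a..b}"
    by (rule mult_continuous_absolutely_integrable[OF f contg])
  have Fg': "(\<lambda>x. F x * g' x) integrable_on {a..b}"
    by (intro integrable_continuous_real continuous_intros contF g')
  have absf: "(\<lambda>x. \<bar>f x\<bar>) integrable_on {a..b}"
    using f unfolding absolutely_integrable_on_def real_norm_def by simp
  have "bounded (g' ` {a..b})"
    by (rule compact_imp_bounded[OF compact_continuous_image[OF g' compact_Icc]])
  then obtain L where "\<forall>y\<in>g' ` {a..b}. norm y \<le> L"
    unfolding bounded_iff by blast
  then have L: "\<And>x. x \<in> {a..b} \<Longrightarrow> \<bar>g' x\<bar> \<le> L"
    by simp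
  have "L \<ge> 0" using L[of a] \<open>a \<le> b\<close> by force
  define D where "D x = integral {a..x} (\<lambda>x. f x * g x) + integral {a..x} (\<lambda>x. F x * g' x) - F x * g x" for x
  define \<Phi> where "\<Phi> x = integral {a..x} (\<lambda>x. \<bar>f x\<bar>)" for x
  have g_lip: "\<bar>g t - g s\<bar> \<le> L * (t - s)" if "s \<in> {a..b}" "t \<in> {a..b}" "s \<le> t" for s t
    using field_differentiable_bound[of "{a..b}" g g' L t s] g L that by auto
  have step: "\<bar>D y - D x\<bar> \<le> 2 * L * (y - x) * (\<Phi> y - \<Phi> x)"
    if xy: "a \<le> x" "x \<le> y" "y \<le> b" for x y
  proof -
    have sub: "{x..y} \<subseteq> {a..b}" using xy by auto
    note ion = integrable_on_subinterval[OF _ sub]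
    have f1: "f integrable_on {x..y}"
      using ion absolutely_integrable_imp_integrable_on f by blast
    have fg1: "(\<lambda>s. f s * g s) integrable_on {x..y}"
      using ion absolutely_integrable_imp_integrable_on fg by blast
    have g'1: "g' integrable_on {x..y}"
      using ion integrable_continuous_real g' by blast
    have Fg1: "(\<lambda>s. F s * g' s) integrable_on {x..y}"
      using ion Fg' by blast
    have af1: "(\<lambda>s. \<bar>f s\<bar>) integrable_on {x..y}"
      using ion absf by blast
    have split: "integral {a..y} h - integral {a..x} h = integral {x..y} h"
      if "h integrable_on {a..b}" for h :: "real \<Rightarrow> real"
    proof -
      have "h integrable_on {a..y}"
        by (rule integrable_on_subinterval[OF that]) (use xy in auto)
      then show ?thesis
        using Henstock_Kurzweil_Integration.integral_combine[of a x y h] xy by simp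
    qed
    have dF: "integral {x..s} f = F s - F x" if "s \<in> {x..y}" for s
      by (rule primitive_onD(2)[OF F]) (use that xy in auto)
    have dg: "integral {x..y} g' = g y - g x"
    proof (intro integral_unique fundamental_theorem_of_calculus xy(2))
      fix s assume "s \<in> {x..y}"
      then show "(g has_vector_derivative g' s) (at s within {x..y})"
        using has_field_derivative_subset[OF g sub] sub
        by (auto simp flip: has_real_derivative_iff_has_vector_derivative)
    qed
    have d\<Phi>: "integral {x..y} (\<lambda>s. \<bar>f s\<bar>) = \<Phi> y - \<Phi> x"
      using split[OF absf] by (simp add: \<Phi>_def)
    have "D y - D x = integral {x..y} (\<lambda>s. f s * g s) + integral {x..y} (\<lambda>s. F s * g' s)
        - (g y * (F y - F x) + F x * (g y - g x))"
      using split[OF absolutely_integrable_imp_integrable_on[OF fg]] split[OF Fg']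
      by (simp add: D_def algebra_simps)
    \<comment> \<open>Freezing \<open>g\<close> at \<open>y\<close> and \<open>F\<close> at
      \<open>x\<close> removes precisely \<open>F y * g y - F x * g x\<close>. What remains pairs an
      increment of \<open>g\<close> with \<open>f\<close>, and an increment of \<open>F\<close> with
      \<open>g'\<close>, so both integrals are small to second order.\<close>
    also have "\<dots> = integral {x..y} (\<lambda>s. f s * g s - f s * g y) + integral {x..y} (\<lambda>s. F s * g' s - F x * g' s)"
    proof -
      have "integral {x..y} (\<lambda>s. f s * g s - f s * g y) = integral {x..y} (\<lambda>s. f s * g s) - (F y - F x) * g y"
        using f1 fg1 dF[of y] xy by (simp add: integral_diff integrable_on_mult_left)
      moreover have "integral {x..y} (\<lambda>s. F s * g' s - F x * g' s) = integral {x..y} (\<lambda>s. F s * g' s) - F x * (g y - g x)"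
        using g'1 Fg1 dg by (simp add: integral_diff integrable_on_mult_right)
      ultimately show ?thesis by (simp add: algebra_simps)
    qed
    finally have dec: "D y - D x = integral {x..y} (\<lambda>s. f s * g s - f s * g y)
        + integral {x..y} (\<lambda>s. F s * g' s - F x * g' s)" .
    have 1: "\<bar>integral {x..y} (\<lambda>s. f s * g s - f s * g y)\<bar> \<le> integral {x..y} (\<lambda>s. L * (y - x) * \<bar>f s\<bar>)"
    proof (rule abs_integral_le)
      show "(\<lambda>s. f s * g s - f s * g y) integrable_on {x..y}"
        by (rule Henstock_Kurzweil_Integration.integrable_diff[OF fg1 integrable_on_mult_left[OF f1]])
      show "(\<lambda>s. L * (y - x) * \<bar>f s\<bar>) integrable_on {x..y}"
        using af1 by (intro integrable_on_mult_right)
      fix s assume s: "s \<in> {x..y}"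
      have "\<bar>f s * g s - f s * g y\<bar> = \<bar>g y - g s\<bar> * \<bar>f s\<bar>"
        by (simp add: abs_mult[symmetric] algebra_simps abs_minus_commute)
      also have "\<bar>g y - g s\<bar> \<le> L * (y - s)"
        using g_lip[of s y] s xy by auto
      also have "L * (y - s) \<le> L * (y - x)"
        using s \<open>L \<ge> 0\<close> by (intro mult_left_mono) auto
      finally show "\<bar>f s * g s - f s * g y\<bar> \<le> L * (y - x) * \<bar>f s\<bar>"
        by (simp add: mult_right_mono)
    qed
    have 2: "\<bar>integral {x..y} (\<lambda>s. F s * g' s - F x * g' s)\<bar> \<le> integral {x..y} (\<lambda>s. L * (\<Phi> y - \<Phi> x))"
    proof (rule abs_integral_le)
      show "(\<lambda>s. F s * g' s - F x * g' s) integrable_on {x..y}"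
        by (rule Henstock_Kurzweil_Integration.integrable_diff[OF Fg1 integrable_on_mult_right[OF g'1]])
      fix s assume s: "s \<in> {x..y}"
      have "\<bar>F s - F x\<bar> = \<bar>integral {x..s} f\<bar>"
        using dF[OF s] by simp
      also have "\<dots> \<le> integral {x..s} (\<lambda>s. \<bar>f s\<bar>)"
        using s integrable_on_subinterval[OF f1, of x s] integrable_on_subinterval[OF af1, of x s]
        by (intro abs_integral_le) auto
      also have "\<dots> \<le> integral {x..y} (\<lambda>s. \<bar>f s\<bar>)"
        using af1 s integrable_on_subinterval[OF af1, of x s] by (intro integral_subset_le) auto
      finally have "\<bar>F s - F x\<bar> \<le> \<Phi> y - \<Phi> x"
        by (simp add: d\<Phi>)
      moreover have "\<bar>g' s\<bar> \<le> L"
        using L s sub by blast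
      ultimately have "\<bar>F s - F x\<bar> * \<bar>g' s\<bar> \<le> (\<Phi> y - \<Phi> x) * L"
        by (intro mult_mono) auto
      then show "\<bar>F s * g' s - F x * g' s\<bar> \<le> L * (\<Phi> y - \<Phi> x)"
        by (simp add: abs_mult[symmetric] algebra_simps)
    qed auto
    have e: "integral {x..y} (\<lambda>s. L * (y - x) * \<bar>f s\<bar>) = L * (y - x) * (\<Phi> y - \<Phi> x)"
      "integral {x..y} (\<lambda>s. L * (\<Phi> y - \<Phi> x)) = L * (y - x) * (\<Phi> y - \<Phi> x)"
      using xy by (simp_all add: d\<Phi> mult_ac)
    show ?thesis
      using 1 2 unfolding dec e by linarith
  qed
  have "(D has_real_derivative 0) (at x within {a..b})" if x: "x \<in> {a..b}" for x
  proof -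
    have "continuous_on {a..b} (\<lambda>x. integral {a..x} (\<lambda>x. \<bar>f x\<bar>))"
      by (rule indefinite_integral_continuous_1[OF absf])
    then have "continuous_on {a..b} \<Phi>"
      by (simp add: \<Phi>_def[abs_def])
    then have "(\<Phi> \<longlongrightarrow> \<Phi> x) (at x within {a..b})"
      using x unfolding continuous_on_def by blast
    then have "((\<lambda>y. 2 * L * \<bar>\<Phi> y - \<Phi> x\<bar>) \<longlongrightarrow> 2 * L * \<bar>\<Phi> x - \<Phi> x\<bar>) (at x within {a..b})"
      by (intro tendsto_intros)
    then have lim: "((\<lambda>y. 2 * L * \<bar>\<Phi> y - \<Phi> x\<bar>) \<longlongrightarrow> 0) (at x within {a..b})"
      by simp
    have bd: "\<bar>D y - D x\<bar> \<le> 2 * L * \<bar>y - x\<bar> * \<bar>\<Phi> y - \<Phi> x\<bar>" if "y \<in> {a..b}" for y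
    proof (cases "x \<le> y")
      case True
      have "\<bar>D y - D x\<bar> \<le> 2 * L * (y - x) * (\<Phi> y - \<Phi> x)"
        using step[of x y] True x that by auto
      also have "\<dots> \<le> 2 * L * (y - x) * \<bar>\<Phi> y - \<Phi> x\<bar>"
        using True \<open>L \<ge> 0\<close> by (intro mult_left_mono) auto
      finally show ?thesis using True by simp
    next
      case False
      have "\<bar>D x - D y\<bar> \<le> 2 * L * (x - y) * (\<Phi> x - \<Phi> y)"
        using step[of y x] False x that by auto
      also have "\<dots> \<le> 2 * L * (x - y) * \<bar>\<Phi> x - \<Phi> y\<bar>"
        using False \<open>L \<ge> 0\<close> by (intro mult_left_mono) auto
      finally show ?thesis using False by (simp add: abs_minus_commute)
    qed
    have "((\<lambda>y. (D y - D x) / (y - x)) \<longlongrightarrow> 0) (at x within {a..b})"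
    proof (rule Lim_null_comparison[OF _ lim])
      show "\<forall>\<^sub>F y in at x within {a..b}. norm ((D y - D x) / (y - x)) \<le> 2 * L * \<bar>\<Phi> y - \<Phi> x\<bar>"
        unfolding eventually_at_filter
        using bd by (intro always_eventually allI impI) (simp add: field_simps)
    qed
    then show ?thesis
      by (simp add: has_field_derivative_iff)
  qed
  then obtain c where "\<And>x. x \<in> {a..b} \<Longrightarrow> D x = c"
    using has_field_derivative_zero_constant[of "{a..b}" D] by blast
  then have "D b = D a"
    using \<open>a \<le> b\<close> by simp
  then show ?thesis
    by (simp add: D_def)
qed

lemma test_by_parts:
  assumes F: "primitive_on {..<0} f F" and \<phi>: "\<phi> \<in> test_functions"
  shows "integral {..<0} (\<lambda>z. f z * \<phi> z) = - integral {..<0} (\<lambda>z. F z * deriv \<phi> z)"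
proof -
  obtain a b where ab: "a < b" "b < 0" "\<And>x. x \<notin> {a<..<b} \<Longrightarrow> \<phi> x = 0"
    using test_support[OF \<phi>] by metis
  have "integral {..<0} (\<lambda>z. f z * \<phi> z) = integral {a..b} (\<lambda>z. f z * \<phi> z)"
    by (rule integral_support) (use ab in auto)
  also have "\<dots> = F b * \<phi> b - F a * \<phi> a - integral {a..b} (\<lambda>x. F x * deriv \<phi> x)"
    using ab(1,2)
    by (intro primitive_by_parts primitive_on_subset[OF F] smooth_continuous_on smooth_deriv
        has_field_derivative_at_within[OF smooth_DERIV] test_smooth \<phi>) auto
  also have "integral {a..b} (\<lambda>x. F x * deriv \<phi> x) = integral {..<0} (\<lambda>x. F x * deriv \<phi> x)"
  proof (rule integral_support[symmetric])
    show "F x * deriv \<phi> x = 0" if "x \<notin> {a..b}" for x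
      using deriv_zero_outside[of a b \<phi> x] ab(3) that by auto
  qed (use ab in auto)
  finally show ?thesis
    using ab by simp
qed

lemma primitive_locally_integrable:
  assumes "primitive_on {..<0} f F" shows "locally_integrable_neg F"
  unfolding locally_integrable_neg_def
  by (intro allI impI absolutely_integrable_continuous_real primitive_on_continuous[OF assms]) auto

section \<open>Square integrable functions on the half-line and their primitives\<close>

lemma L2_neg_absolutely_integrable:
  assumes "f \<in> L2_neg" "b \<le> 0"
  shows "f absolutely_integrable_on {a..b}"
proof -
  have sub: "{a<..<b} \<subseteq> {..<0::real}" using assms(2) by auto
  have "(\<lambda>z. (f z)\<^sup>2) absolutely_integrable_on {..<0}"
    using assms(1) by (simp add: L2_neg_def set_integrable_def integrable_restrict_space)
  then have "(\<lambda>z. (f z)\<^sup>2) absolutely_integrable_on {a<..<b}"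
    by (rule set_integrable_subset) (use sub in auto)
  then have i: "(\<lambda>z. (f z)\<^sup>2 + 1) integrable_on {a<..<b}"
    by (intro integrable_add absolutely_integrable_imp_integrable_on) auto
  have m: "f \<in> borel_measurable (lebesgue_on {a<..<b})"
    by (rule measurable_restrict_mono[OF _ sub]) (use assms(1) in \<open>simp add: L2_neg_def\<close>)
  \<comment> \<open>On a bounded interval the constant 1 is integrable, so this bound suffices. It
    covers \<open>b = 0\<close>, which is what lets the primitive reach the boundary.\<close>
  have n: "norm (f x) \<le> (f x)\<^sup>2 + 1" for x
    using zero_le_power2[of "\<bar>f x\<bar> - 1"] by (simp add: power2_diff)
  have "f absolutely_integrable_on {a<..<b}"
    by (rule measurable_bounded_by_integrable_imp_absolutely_integrable[OF m _ i n]) simp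
  then show ?thesis
    by (simp add: absolutely_integrable_on_Icc_iff_Ioo)
qed

lemma L2_neg_locally_integrable: "f \<in> L2_neg \<Longrightarrow> locally_integrable_neg f"
  by (simp add: locally_integrable_neg_def L2_neg_absolutely_integrable)

lemma integral_leb_neg:
  fixes f :: "real \<Rightarrow> real"
  assumes "f absolutely_integrable_on {..<0}"
  shows "integrable leb_neg f" "integral\<^sup>L leb_neg f = integral {..<0} f"
proof -
  show "integrable leb_neg f"
    by (rule absolutely_integrable_imp_integrable[OF assms]) simp
  then show "integral\<^sup>L leb_neg f = integral {..<0} f"
    by (rule lebesgue_integral_eq_integral) simp
qed

lemma L2_neg_square:
  assumes "f \<in> L2_neg"
  shows "(\<lambda>z. (f z)\<^sup>2) absolutely_integrable_on {..<0}"
  using assms by (simp add: L2_neg_def set_integrable_def integrable_restrict_space)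

lemma L2_neg_mult:
  assumes "f \<in> L2_neg" "g \<in> L2_neg"
  shows "(\<lambda>z. f z * g z) absolutely_integrable_on {..<0}"
proof (rule measurable_bounded_by_integrable_imp_absolutely_integrable[of _ _ "\<lambda>z. (f z)\<^sup>2 + (g z)\<^sup>2"])
  show "(\<lambda>z. f z * g z) \<in> borel_measurable leb_neg"
    using assms by (auto simp: L2_neg_def)
  show "(\<lambda>z. (f z)\<^sup>2 + (g z)\<^sup>2) integrable_on {..<0}"
    using assms by (intro integrable_add absolutely_integrable_imp_integrable_on L2_neg_square)
  fix z
  have "0 \<le> \<bar>f z\<bar> * \<bar>g z\<bar>" by simp
  moreover have "2 * (\<bar>f z\<bar> * \<bar>g z\<bar>) \<le> (f z)\<^sup>2 + (g z)\<^sup>2"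
    using zero_le_power2[of "\<bar>f z\<bar> - \<bar>g z\<bar>"] by (simp add: power2_diff)
  ultimately show "norm (f z * g z) \<le> (f z)\<^sup>2 + (g z)\<^sup>2"
    unfolding real_norm_def abs_mult by linarith
qed simp

definition L2_primitive :: "(real \<Rightarrow> real) \<Rightarrow> real \<Rightarrow> real" where
  "L2_primitive f z = - integral {z..0} f"

lemma L2_primitive_0 [simp]: "L2_primitive f 0 = 0"
  by (simp add: L2_primitive_def)

lemma L2_primitive:
  assumes "f \<in> L2_neg" shows "primitive_on {..0} f (L2_primitive f)"
  unfolding primitive_on_def
proof (intro allI impI conjI)
  fix a b :: real assume ab: "a \<le> b" "{a..b} \<subseteq> {..0}"
  then have "b \<le> 0" by auto
  then show "f absolutely_integrable_on {a..b}"
    using assms by (rule L2_neg_absolutely_integrable[rotated])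
  have "f integrable_on {a..0}"
    using assms by (intro absolutely_integrable_imp_integrable_on L2_neg_absolutely_integrable) auto
  then show "integral {a..b} f = L2_primitive f b - L2_primitive f a"
    using Henstock_Kurzweil_Integration.integral_combine[of a b 0 f] ab \<open>b \<le> 0\<close> by (simp add: L2_primitive_def)
qed

text \<open>Instead of the Cauchy-Schwarz inequality the proof integrates
  \<open>\<bar>f\<bar> \<le> r / 2 * f^2 + 1 / (2 * r)\<close> over \<open>{z<..<0}\<close>. With
  \<open>r = sqrt (- z)\<close> both terms are of order \<open>r\<close>, giving
  \<open>M / 2 + 1 / 2\<close> as the constant.\<close>

lemma L2_primitive_growth:
  assumes "f \<in> L2_neg"
  obtains K where "K \<ge> 0" "\<And>z. z \<le> 0 \<Longrightarrow> \<bar>L2_primitive f z\<bar> \<le> K * sqrt (- z)"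
proof
  define M where "M = integral {..<0} (\<lambda>z. (f z)\<^sup>2)"
  show "(M + 1) / 2 \<ge> 0"
    using L2_neg_square[OF assms] by (auto simp: M_def intro!: integral_nonneg absolutely_integrable_imp_integrable_on add_nonneg_nonneg)
  fix z :: real assume "z \<le> 0"
  show "\<bar>L2_primitive f z\<bar> \<le> (M + 1) / 2 * sqrt (- z)"
  proof (cases "z = 0")
    case False
    define r where "r = sqrt (- z)"
    have r: "r > 0" "r * r = - z"
      using False \<open>z \<le> 0\<close> by (auto simp: r_def)
    have f2: "(\<lambda>s. (f s)\<^sup>2) integrable_on {z<..<0}"
      by (rule absolutely_integrable_imp_integrable_on, rule set_integrable_subset[OF L2_neg_square[OF assms]]) auto
    have const: "((\<lambda>s. 1 / r) has_integral - z * (1 / r)) {z<..<0}"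
      using has_integral_const_real[of "1 / r" z 0] \<open>z \<le> 0\<close> by (simp add: has_integral_Icc_iff_Ioo)
    have "\<bar>integral {z<..<0} f\<bar> \<le> integral {z<..<0} (\<lambda>s. r / 2 * (f s)\<^sup>2 + 1 / 2 * (1 / r))"
    proof (rule abs_integral_le)
      show "f integrable_on {z<..<0}"
        using L2_neg_absolutely_integrable[OF assms, of 0 z]
        by (simp add: absolutely_integrable_on_Icc_iff_Ioo absolutely_integrable_imp_integrable_on)
      show "(\<lambda>s. r / 2 * (f s)\<^sup>2 + 1 / 2 * (1 / r)) integrable_on {z<..<0}"
        using f2 const by (intro integrable_add integrable_on_mult_right) blast+
      fix s
      have "0 \<le> (r * \<bar>f s\<bar> - 1)\<^sup>2 / (2 * r)"
        using r by simp
      also have "\<dots> = r / 2 * (f s)\<^sup>2 + 1 / 2 * (1 / r) - \<bar>f s\<bar>"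
        using r by (simp add: field_simps power2_eq_square)
      finally show "\<bar>f s\<bar> \<le> r / 2 * (f s)\<^sup>2 + 1 / 2 * (1 / r)" by simp
    qed
    also have "\<dots> = r / 2 * integral {z<..<0} (\<lambda>s. (f s)\<^sup>2) + 1 / 2 * (- z * (1 / r))"
      by (intro integral_unique has_integral_add has_integral_mult_right const integrable_integral f2)
    also have "- z * (1 / r) = r"
      using r by (simp add: field_simps)
    also have "integral {z<..<0} (\<lambda>s. (f s)\<^sup>2) \<le> M"
      unfolding M_def
      by (rule integral_subset_le) (use f2 L2_neg_square[OF assms] absolutely_integrable_imp_integrable_on in auto)
    finally have "\<bar>integral {z<..<0} f\<bar> \<le> r / 2 * M + 1 / 2 * r"
      using r by simp
    moreover have "integral {z..0} f = integral {z<..<0} f"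
      by (simp add: integral_open_interval_real)
    ultimately show ?thesis
      by (simp add: L2_primitive_def r_def algebra_simps)
  qed simp
qed

section \<open>Regularity of weak solutions\<close>

lemma distr_of_eq:
  assumes "locally_integrable_neg k" "\<phi> \<in> test_functions"
  shows "distr_of k \<phi> = integral {..<0} (\<lambda>z. k z * \<phi> z)"
  unfolding distr_of_def by (rule integral_leb_neg(2)[OF test_mult_integrable[OF assms]])

text \<open>The formal adjoint of \<open>H\<close>, as a function of the derivative \<open>\<psi> = \<phi>'\<close> of the test function.\<close>

definition H_adj :: "(real \<Rightarrow> real) \<Rightarrow> real \<Rightarrow> real" where
  "H_adj \<psi> z = - (z * deriv \<psi> z) + \<psi> z - z\<^sup>2 / 4 * \<psi> z"

lemma H_adj_test:
  assumes "\<psi> \<in> test_functions" shows "H_adj \<psi> \<in> test_functions"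
proof -
  have "(\<lambda>z. (1 + (- (1 / 4)) * (z * z)) * \<psi> z - 1 * (z * deriv \<psi> z)) \<in> test_functions"
    by (intro test_diff_scaled test_mult smooth_add smooth_mult smooth_const smooth_id test_deriv assms)
  moreover have "(\<lambda>z. (1 + (- (1 / 4)) * (z * z)) * \<psi> z - 1 * (z * deriv \<psi> z)) = H_adj \<psi>"
    by (simp add: fun_eq_iff H_adj_def algebra_simps power2_eq_square)
  ultimately show ?thesis by simp
qed

text \<open>Moving all derivatives to the test function gives
  \<open>(z \<phi>)'' = z \<phi>'' + 2 \<phi>'\<close>, in which \<open>\<phi>\<close> itself no
  longer occurs. That only \<open>\<phi>'\<close> enters is the weak form of \<open>H\<close> being
  an exact derivative.\<close>

lemma H_distr_eq:
  assumes w: "locally_integrable_neg w" and \<phi>: "\<phi> \<in> test_functions"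
  shows "H_distr (distr_of w) \<phi> = integral {..<0} (\<lambda>z. w z * H_adj (deriv \<phi>) z)"
proof -
  define \<psi> where "\<psi> = deriv \<phi>"
  have \<psi>: "\<psi> \<in> test_functions" "deriv \<psi> \<in> test_functions"
    unfolding \<psi>_def by (intro test_deriv \<phi>)+
  have D\<phi>: "(\<phi> has_real_derivative \<psi> z) (at z)" for z
    unfolding \<psi>_def by (rule smooth_DERIV[OF test_smooth[OF \<phi>]])
  have D\<psi>: "(\<psi> has_real_derivative deriv \<psi> z) (at z)" for z
    by (rule smooth_DERIV[OF test_smooth[OF \<psi>(1)]])
  have d1: "deriv (\<lambda>z. z * \<phi> z) = (\<lambda>z. z * \<psi> z + \<phi> z)"
    by (rule ext, rule DERIV_imp_deriv) (rule derivative_eq_intros D\<phi> refl | simp)+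
  \<comment> \<open>The sum is written as the subtraction of a multiple, the shape that
    \<open>test_diff_scaled\<close> and \<open>test_integral_lin\<close> handle.\<close>
  have d2: "deriv (\<lambda>z. z * \<psi> z + \<phi> z) = (\<lambda>z. z * deriv \<psi> z - (- 2) * \<psi> z)"
    by (rule ext, rule DERIV_imp_deriv) (rule derivative_eq_intros D\<phi> D\<psi> refl | simp)+
  have t1: "(\<lambda>z. z * deriv \<psi> z) \<in> test_functions"
    by (intro test_mult smooth_id \<psi>)
  have t2: "(\<lambda>z. z * deriv \<psi> z - (- 2) * \<psi> z) \<in> test_functions"
    by (intro test_diff_scaled t1 \<psi>)
  have "(\<lambda>z. (z * z) * \<psi> z) \<in> test_functions"
    by (intro test_mult smooth_mult smooth_id \<psi>)
  then have t3: "(\<lambda>z. z\<^sup>2 * \<psi> z) \<in> test_functions"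
    by (simp add: power2_eq_square)
  have t4: "(\<lambda>z. \<psi> z - 1 / 4 * (z\<^sup>2 * \<psi> z)) \<in> test_functions"
    by (intro test_diff_scaled t3 \<psi>)
  have "H_distr (distr_of w) \<phi> = - distr_of w (\<lambda>z. z * deriv \<psi> z - (- 2) * \<psi> z)
      + 3 * distr_of w \<psi> - 1 / 4 * distr_of w (\<lambda>z. z\<^sup>2 * \<psi> z)"
    unfolding H_distr_def distr_mult_def distr_deriv_def d1 d2 \<psi>_def[symmetric] by simp
  also have "\<dots> = - integral {..<0} (\<lambda>z. w z * (z * deriv \<psi> z)) + integral {..<0} (\<lambda>z. w z * \<psi> z)
      - 1 / 4 * integral {..<0} (\<lambda>z. w z * (z\<^sup>2 * \<psi> z))"
    unfolding distr_of_eq[OF w t2] distr_of_eq[OF w t3] distr_of_eq[OF w \<psi>(1)]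
      test_integral_lin[OF w t1 \<psi>(1)] by simp
  also have "\<dots> = integral {..<0} (\<lambda>z. w z * ((\<psi> z - 1 / 4 * (z\<^sup>2 * \<psi> z)) - 1 * (z * deriv \<psi> z)))"
    unfolding test_integral_lin[OF w t4 t1] test_integral_lin[OF w \<psi>(1) t3] by simp
  also have "(\<lambda>z. w z * ((\<psi> z - 1 / 4 * (z\<^sup>2 * \<psi> z)) - 1 * (z * deriv \<psi> z))) = (\<lambda>z. w z * H_adj \<psi> z)"
    by (simp add: fun_eq_iff H_adj_def algebra_simps)
  finally show ?thesis
    by (simp add: \<psi>_def)
qed

lemma H_adj_lin:
  assumes "\<psi> \<in> test_functions" "\<eta> \<in> test_functions"
  shows "H_adj (\<lambda>z. \<psi> z - c * \<eta> z) = (\<lambda>z. H_adj \<psi> z - c * H_adj \<eta> z)"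
proof
  fix z
  have *: "deriv (\<lambda>z. \<psi> z - c * \<eta> z) z = deriv \<psi> z - c * deriv \<eta> z"
    by (rule DERIV_imp_deriv)
      (intro DERIV_diff DERIV_cmult smooth_DERIV test_smooth assms)
  show "H_adj (\<lambda>z. \<psi> z - c * \<eta> z) z = H_adj \<psi> z - c * H_adj \<eta> z"
    unfolding H_adj_def * by (simp add: field_simps)
qed

text \<open>On derivatives of test functions the two integrals cancel, by \<open>H_distr_eq\<close>
  and integration by parts. The constant \<open>c\<close> is therefore the constant of integration
  of the first-order equation.\<close>

lemma first_order_weak:
  assumes w: "w \<in> L2_neg" and f: "represents_H w f"
  shows "\<exists>c. \<forall>\<psi>\<in>test_functions. integral {..<0} (\<lambda>z. w z * H_adj \<psi> z)
    + integral {..<0} (\<lambda>z. L2_primitive f z * \<psi> z) = c * integral {..<0} \<psi>"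
proof -
  have f2: "f \<in> L2_neg"
    using f by (simp add: represents_H_def)
  have F: "primitive_on {..<0} f (L2_primitive f)"
    by (rule primitive_on_subset[OF L2_primitive[OF f2]]) auto
  note lw = L2_neg_locally_integrable[OF w]
  note lF = primitive_locally_integrable[OF F]
  show ?thesis
  proof (rule test_functional_const)
    fix \<phi> assume \<phi>: "\<phi> \<in> test_functions"
    have "H_distr (distr_of w) \<phi> = distr_of f \<phi>"
      using f \<phi> by (simp add: represents_H_def)
    then have "integral {..<0} (\<lambda>z. w z * H_adj (deriv \<phi>) z) = integral {..<0} (\<lambda>z. f z * \<phi> z)"
      by (simp only: H_distr_eq[OF lw \<phi>] distr_of_eq[OF L2_neg_locally_integrable[OF f2] \<phi>])
    then show "integral {..<0} (\<lambda>z. w z * H_adj (deriv \<phi>) z)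
        + integral {..<0} (\<lambda>z. L2_primitive f z * deriv \<phi> z) = 0"
      using test_by_parts[OF F \<phi>] by simp
  next
    fix \<psi> \<eta> :: "real \<Rightarrow> real" and c :: real
    assume t: "\<psi> \<in> test_functions" "\<eta> \<in> test_functions"
    show "integral {..<0} (\<lambda>z. w z * H_adj (\<lambda>x. \<psi> x - c * \<eta> x) z)
        + integral {..<0} (\<lambda>z. L2_primitive f z * (\<psi> z - c * \<eta> z))
      = integral {..<0} (\<lambda>z. w z * H_adj \<psi> z) + integral {..<0} (\<lambda>z. L2_primitive f z * \<psi> z)
        - c * (integral {..<0} (\<lambda>z. w z * H_adj \<eta> z) + integral {..<0} (\<lambda>z. L2_primitive f z * \<eta> z))"
      unfolding H_adj_lin[OF t] test_integral_lin[OF lw H_adj_test[OF t(1)] H_adj_test[OF t(2)]]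
        test_integral_lin[OF lF t] by (simp add: algebra_simps)
  qed
qed

lemma continuous_primitive:
  fixes p :: "real \<Rightarrow> real"
  assumes "continuous_on {..0} p" "z < 0"
  shows "((\<lambda>z. - integral {z..0} p) has_real_derivative p z) (at z)"
proof -
  have "continuous_on {z - 1..0} p"
    using assms(1) by (rule continuous_on_subset) auto
  then have "((\<lambda>x. integral {x..0} p) has_real_derivative - p z) (at z within {z - 1..0})"
    using assms(2) by (intro integral_has_real_derivative') auto
  then have "((\<lambda>x. integral {x..0} p) has_real_derivative - p z) (at z)"
    using assms(2) by (simp add: at_within_Icc_at)
  then show ?thesis
    using DERIV_minus by fastforce
qed

lemma L2_primitive_continuous:
  assumes "f \<in> L2_neg" shows "continuous_on {..0} (L2_primitive f)"
  unfolding continuous_on_eq_continuous_within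
proof
  fix z :: real assume z: "z \<in> {..0}"
  have "continuous_on {z - 1..0} (L2_primitive f)"
    by (rule primitive_on_continuous[OF L2_primitive[OF assms]]) auto
  then have "continuous (at z within {z - 1..0}) (L2_primitive f)"
    using z by (auto simp: continuous_on_eq_continuous_within)
  moreover have "at z within {z - 1..0} = at z within {..0}"
    by (rule at_within_nhd[of _ "{z - 1<..}"]) auto
  ultimately show "continuous (at z within {..0}) (L2_primitive f)"
    by simp
qed

text \<open>For \<open>\<psi> = z e \<eta>\<close> all terms without \<open>\<eta>'\<close> cancel
  in \<open>H_adj \<psi>\<close> and only \<open>- z^2 e \<eta>'\<close> is left, since
  \<open>z e\<close> is the integrating factor. Hence \<open>z^2 e w - P\<close> is almost
  everywhere a constant, and \<open>h\<close> is \<open>P\<close> plus that constant: it is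
  differentiable at every negative point although it agrees with the weighted \<open>w\<close> only
  off \<open>N\<close>.\<close>

lemma regularity:
  assumes w: "w \<in> L2_neg" and f: "represents_H w f"
  obtains c h N where "negligible N"
    "\<And>z. z < 0 \<Longrightarrow> (h has_real_derivative - (z * exp (- z\<^sup>2 / 8)) * (L2_primitive f z - c)) (at z)"
    "\<And>z. z < 0 \<Longrightarrow> z \<notin> N \<Longrightarrow> h z = z\<^sup>2 * exp (- z\<^sup>2 / 8) * w z"
proof -
  have f2: "f \<in> L2_neg"
    using f by (simp add: represents_H_def)
  define F where "F = L2_primitive f"
  obtain c where c: "\<And>\<psi>. \<psi> \<in> test_functions \<Longrightarrow> integral {..<0} (\<lambda>z. w z * H_adj \<psi> z)
      + integral {..<0} (\<lambda>z. F z * \<psi> z) = c * integral {..<0} \<psi>"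
    using first_order_weak[OF w f] unfolding F_def by blast
  define e where "e z = exp (- z\<^sup>2 / 8)" for z :: real
  define p where "p z = - (z * e z) * (F z - c)" for z
  define P where "P z = - integral {z..0} p" for z
  have Fc: "continuous_on {..0} F"
    unfolding F_def by (rule L2_primitive_continuous[OF f2])
  have es: "e \<in> smooth"
    unfolding e_def[abs_def] by (rule smooth_gauss)
  have pc: "continuous_on {..0} p"
    unfolding p_def[abs_def] by (intro continuous_intros smooth_continuous_on es Fc)
  have DP: "(P has_real_derivative p z) (at z)" if "z < 0" for z
    unfolding P_def[abs_def] by (rule continuous_primitive[OF pc that])
  have P: "primitive_on {..<0} p P"
    by (rule primitive_on_DERIV) (use DP pc in \<open>auto intro: continuous_on_subset\<close>)
  note lw = L2_neg_locally_integrable[OF w]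
  have lF: "locally_integrable_neg F"
    by (rule locally_integrable_continuous[OF continuous_on_subset[OF Fc]]) auto
  have l1: "locally_integrable_neg (\<lambda>z. 1)"
    by (rule locally_integrable_continuous) auto
  define k where "k z = w z * (z\<^sup>2 * e z) - P z" for z
  have lwe: "locally_integrable_neg (\<lambda>z. w z * (z\<^sup>2 * e z))"
    by (intro locally_integrable_mult_continuous lw continuous_intros smooth_continuous_on es)
  have lk: "locally_integrable_neg k"
    unfolding k_def by (intro locally_integrable_diff lwe primitive_locally_integrable[OF P])
  have "integral {..<0} (\<lambda>z. k z * deriv \<eta> z) = 0" if \<eta>: "\<eta> \<in> test_functions" for \<eta>
  proof -
    define \<psi> where "\<psi> z = (z * e z) * \<eta> z" for z
    have \<psi>: "\<psi> \<in> test_functions"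
      unfolding \<psi>_def[abs_def] by (intro test_mult smooth_mult smooth_id es \<eta>)
    have "(\<psi> has_real_derivative (z * e z) * deriv \<eta> z + (1 - z\<^sup>2 / 4) * e z * \<eta> z) (at z)" for z
      unfolding \<psi>_def[abs_def] e_def
      by (rule derivative_eq_intros smooth_DERIV[OF test_smooth[OF \<eta>]] refl
          | simp add: algebra_simps power2_eq_square)+
    then have D\<psi>: "deriv \<psi> z = (z * e z) * deriv \<eta> z + (1 - z\<^sup>2 / 4) * e z * \<eta> z" for z
      by (rule DERIV_imp_deriv)
    have H\<psi>: "w z * H_adj \<psi> z = - (w z * (z\<^sup>2 * e z) * deriv \<eta> z)" for z
      unfolding H_adj_def D\<psi> by (simp add: \<psi>_def field_simps power2_eq_square)
    have "integral {..<0} (\<lambda>z. p z * \<eta> z) = integral {..<0} (\<lambda>z. c * \<psi> z - F z * \<psi> z)"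
      by (simp add: p_def \<psi>_def algebra_simps)
    also have "\<dots> = c * integral {..<0} \<psi> - integral {..<0} (\<lambda>z. F z * \<psi> z)"
      using test_mult_integrable_on[OF l1 \<psi>] test_mult_integrable_on[OF lF \<psi>]
      by (subst integral_diff) (simp_all add: integrable_on_mult_right)
    also have "\<dots> = integral {..<0} (\<lambda>z. w z * H_adj \<psi> z)"
      using c[OF \<psi>] by simp
    also have "\<dots> = - integral {..<0} (\<lambda>z. w z * (z\<^sup>2 * e z) * deriv \<eta> z)"
      unfolding H\<psi> by simp
    finally have "integral {..<0} (\<lambda>z. w z * (z\<^sup>2 * e z) * deriv \<eta> z) = integral {..<0} (\<lambda>z. P z * deriv \<eta> z)"
      using test_by_parts[OF P \<eta>] by simp
    moreover have "integral {..<0} (\<lambda>z. k z * deriv \<eta> z)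
        = integral {..<0} (\<lambda>z. w z * (z\<^sup>2 * e z) * deriv \<eta> z - P z * deriv \<eta> z)"
      unfolding k_def by (simp only: left_diff_distrib)
    moreover have "\<dots> = integral {..<0} (\<lambda>z. w z * (z\<^sup>2 * e z) * deriv \<eta> z) - integral {..<0} (\<lambda>z. P z * deriv \<eta> z)"
      by (intro integral_diff test_mult_integrable_on lwe primitive_locally_integrable[OF P] test_deriv \<eta>)
    ultimately show ?thesis by simp
  qed
  then obtain C N where N: "negligible N" "\<And>z. z < 0 \<Longrightarrow> z \<notin> N \<Longrightarrow> k z = C"
    using du_Bois_Reymond[OF lk] by blast
  show thesis
  proof (rule that[OF N(1)])
    show "((\<lambda>z. P z + C) has_real_derivative - (z * exp (- z\<^sup>2 / 8)) * (L2_primitive f z - c)) (at z)" if "z < 0" for z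
      using DERIV_add[OF DP[OF that] DERIV_const[of C]] by (simp add: p_def e_def F_def)
    show "P z + C = z\<^sup>2 * exp (- z\<^sup>2 / 8) * w z" if "z < 0" "z \<notin> N" for z
      using N(2)[OF that] unfolding k_def e_def by (simp add: algebra_simps)
  qed
qed

section \<open>Boundary behaviour and energy identity\<close>

text \<open>Both \<open>b - y\<close> and \<open>b + y\<close> are nondecreasing. An explicit
  barrier \<open>b\<close> thereby replaces estimating the integral of \<open>y'\<close>.\<close>

lemma DERIV_compare:
  fixes y b :: "real \<Rightarrow> real"
  assumes "p \<le> q"
    and "\<And>x. p \<le> x \<Longrightarrow> x \<le> q \<Longrightarrow> (y has_real_derivative y' x) (at x)"
    and "\<And>x. p \<le> x \<Longrightarrow> x \<le> q \<Longrightarrow> (b has_real_derivative b' x) (at x)"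
    and "\<And>x. p \<le> x \<Longrightarrow> x \<le> q \<Longrightarrow> \<bar>y' x\<bar> \<le> b' x"
  shows "\<bar>y q - y p\<bar> \<le> b q - b p"
proof -
  have "b p - y p \<le> b q - y q"
  proof (rule DERIV_nonneg_imp_nondecreasing[OF \<open>p \<le> q\<close>])
    fix x assume x: "p \<le> x" "x \<le> q"
    show "\<exists>d. ((\<lambda>x. b x - y x) has_real_derivative d) (at x) \<and> 0 \<le> d"
      using DERIV_diff[OF assms(3)[OF x] assms(2)[OF x]] assms(4)[OF x]
      by (intro exI[of _ "b' x - y' x"]) auto
  qed
  moreover have "b p + y p \<le> b q + y q"
  proof (rule DERIV_nonneg_imp_nondecreasing[OF \<open>p \<le> q\<close>])
    fix x assume x: "p \<le> x" "x \<le> q"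
    show "\<exists>d. ((\<lambda>x. b x + y x) has_real_derivative d) (at x) \<and> 0 \<le> d"
      using DERIV_add[OF assms(3)[OF x] assms(2)[OF x]] assms(4)[OF x]
      by (intro exI[of _ "b' x + y' x"]) auto
  qed
  ultimately show ?thesis by linarith
qed

text \<open>For \<open>h\<close> the equation is a plain quadrature, and \<open>u\<close> is
  recovered by dividing out the weight. The growth bound is asked only from \<open>- 1\<close>
  outwards: \<open>G\<close> need not vanish at 0, and a constant is dominated by
  \<open>sqrt (- z)\<close> only there. Near 0 continuity takes over.\<close>

locale square_integrable_solution =
  fixes u h G :: "real \<Rightarrow> real" and K :: real
  assumes h: "\<And>z. z < 0 \<Longrightarrow> (h has_real_derivative - (z * exp (- z\<^sup>2 / 8)) * G z) (at z)"
    and u: "\<And>z. z < 0 \<Longrightarrow> u z = h z * exp (z\<^sup>2 / 8) / z\<^sup>2"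
    and G: "continuous_on {..0} G"
    and G_growth: "\<And>z. z \<le> -1 \<Longrightarrow> \<bar>G z\<bar> \<le> K * sqrt (- z)"
    and u_square: "(\<lambda>z. (u z)\<^sup>2) integrable_on {..<0}"
begin

lemma h_eq: "z < 0 \<Longrightarrow> h z = z\<^sup>2 * exp (- z\<^sup>2 / 8) * u z"
  by (simp add: u exp_minus field_simps)

definition M where "M = integral {..<0} (\<lambda>z. (u z)\<^sup>2)"

lemma M_nonneg: "M \<ge> 0"
  unfolding M_def using u_square by (intro integral_nonneg) auto

lemma K_nonneg: "K \<ge> 0"
  using G_growth[of "-1"] by (simp add: order_trans[OF abs_ge_zero])

text \<open>A Chebyshev estimate, the only form in which square integrability enters the two
  exclusion arguments for \<open>h\<close>.\<close>

lemma square_bound: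
  assumes "0 \<le> m" "p \<le> q" "q < 0" "\<And>z. p \<le> z \<Longrightarrow> z \<le> q \<Longrightarrow> m \<le> \<bar>u z\<bar>"
  shows "m\<^sup>2 * (q - p) \<le> M"
proof -
  have sub: "{p..q} \<subseteq> {..<0}" using assms by auto
  have i: "(\<lambda>z. (u z)\<^sup>2) integrable_on {p..q}"
    by (rule integrable_on_subinterval[OF u_square sub])
  have "m\<^sup>2 * (q - p) = integral {p..q} (\<lambda>z. m\<^sup>2)"
    using assms by simp
  also have "\<dots> \<le> integral {p..q} (\<lambda>z. (u z)\<^sup>2)"
  proof (rule integral_le[OF _ i])
    show "m\<^sup>2 \<le> (u z)\<^sup>2" if "z \<in> {p..q}" for z
      using power_mono[OF assms(4)[of z] assms(1), of 2] that by simp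
  qed auto
  also have "\<dots> \<le> M"
    unfolding M_def by (rule integral_subset_le[OF sub i u_square]) auto
  finally show ?thesis .
qed

text \<open>If \<open>\<bar>h\<bar> \<ge> \<delta>\<close> near 0, then
  \<open>\<bar>u\<bar> \<ge> \<delta> / r^2\<close> on \<open>{- r..- r / 2}\<close>, so the square
  integral is at least \<open>\<delta>^2 / (2 r^3)\<close>, too large for small
  \<open>r\<close>.\<close>

lemma h_small_near_0:
  assumes "\<delta> > 0" "\<epsilon> > 0" obtains q where "- \<epsilon> < q" "q < 0" "\<bar>h q\<bar> < \<delta>"
proof (rule ccontr)
  assume "\<not> thesis"
  with that have big: "\<And>q. - \<epsilon> < q \<Longrightarrow> q < 0 \<Longrightarrow> \<delta> \<le> \<bar>h q\<bar>"
    by fastforce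
  \<comment> \<open>The bound 1 gives \<open>r^3 \<le> r\<close>, and the last bound then makes
    \<open>2 M r\<close> smaller than \<open>\<delta>^2\<close>; adding 1 to \<open>M\<close> avoids
    a zero denominator.\<close>
  define r where "r = min (min (\<epsilon> / 2) 1) (\<delta>\<^sup>2 / (4 * (M + 1)))"
  have r: "0 < r" "r < \<epsilon>" "r \<le> 1" "r \<le> \<delta>\<^sup>2 / (4 * (M + 1))"
    using assms M_nonneg by (auto simp: r_def)
  have "(\<delta> / r\<^sup>2)\<^sup>2 * (- (r / 2) - - r) \<le> M"
  proof (rule square_bound)
    fix z assume z: "- r \<le> z" "z \<le> - (r / 2)"
    then have "z < 0" "- \<epsilon> < z" using r by auto
    then have "\<delta> \<le> \<bar>h z\<bar>" by (intro big)
    also have "\<dots> = z\<^sup>2 * exp (- z\<^sup>2 / 8) * \<bar>u z\<bar>"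
      using \<open>z < 0\<close> by (simp add: h_eq abs_mult)
    also have "\<dots> \<le> r\<^sup>2 * 1 * \<bar>u z\<bar>"
    proof (intro mult_right_mono mult_mono)
      show "z\<^sup>2 \<le> r\<^sup>2"
        using z \<open>z < 0\<close> by (simp add: abs_le_square_iff[symmetric])
    qed auto
    finally show "\<delta> / r\<^sup>2 \<le> \<bar>u z\<bar>"
      using r by (simp add: field_simps)
  qed (use r assms in auto)
  moreover have "(\<delta> / r\<^sup>2)\<^sup>2 * (- (r / 2) - - r) = \<delta>\<^sup>2 / (2 * r ^ 3)"
    using r by (simp add: field_simps power2_eq_square power3_eq_cube)
  ultimately have "\<delta>\<^sup>2 / (2 * r ^ 3) \<le> M"
    by simp
  then have "\<delta>\<^sup>2 \<le> M * (2 * r ^ 3)"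
    using r by (subst (asm) pos_divide_le_eq) auto
  also have "r ^ 3 \<le> r"
    using r power_decreasing[of 1 3 r] by simp
  then have "M * (2 * r ^ 3) \<le> M * (2 * r)"
    using M_nonneg by (intro mult_left_mono) auto
  also have "\<dots> \<le> M * (2 * (\<delta>\<^sup>2 / (4 * (M + 1))))"
    using M_nonneg r by (intro mult_left_mono) auto
  also have "\<dots> = \<delta>\<^sup>2 * (M / (2 * (M + 1)))"
    using M_nonneg by (simp add: field_simps)
  also have "\<dots> < \<delta>\<^sup>2 * 1"
    using M_nonneg assms by (intro mult_strict_left_mono) (auto simp: field_simps)
  finally show False by simp
qed

text \<open>Because \<open>x exp (- x) \<le> 1\<close> at \<open>x = z^2 / 8\<close>, the weight in
  \<open>h\<close> is at most 8. A lower bound \<open>\<delta>\<close> for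
  \<open>\<bar>h\<bar>\<close> would keep \<open>\<bar>u\<bar>\<close> above
  \<open>\<delta> / 8\<close> on arbitrarily long intervals.\<close>

lemma h_small_far:
  assumes "\<delta> > 0" obtains p where "p \<le> R" "\<bar>h p\<bar> < \<delta>"
proof (rule ccontr)
  assume "\<not> thesis"
  with that have big: "\<And>p. p \<le> R \<Longrightarrow> \<delta> \<le> \<bar>h p\<bar>"
    by fastforce
  define q where "q = min R (-1)"
  \<comment> \<open>This length makes the lower bound for the square integral equal to
    \<open>M + 1\<close>.\<close>
  define L where "L = (M + 1) / (\<delta> / 8)\<^sup>2"
  have "L > 0"
    unfolding L_def using M_nonneg assms by (intro divide_pos_pos) auto
  have "(\<delta> / 8)\<^sup>2 * (q - (q - L)) \<le> M"
  proof (rule square_bound)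
    fix z assume z: "q - L \<le> z" "z \<le> q"
    then have "z < 0" "z \<le> R" by (auto simp: q_def)
    then have "\<delta> \<le> \<bar>h z\<bar>" by (intro big)
    also have "\<dots> = z\<^sup>2 * exp (- z\<^sup>2 / 8) * \<bar>u z\<bar>"
      using \<open>z < 0\<close> by (simp add: h_eq abs_mult)
    also have "\<dots> \<le> 8 * \<bar>u z\<bar>"
    proof (intro mult_right_mono)
      have "z\<^sup>2 / 8 \<le> exp (z\<^sup>2 / 8)"
        using exp_ge_add_one_self[of "z\<^sup>2 / 8"] by linarith
      then have "z\<^sup>2 / 8 * exp (- z\<^sup>2 / 8) \<le> exp (z\<^sup>2 / 8) * exp (- z\<^sup>2 / 8)"
        by (intro mult_right_mono) auto
      also have "\<dots> = 1" by (simp flip: exp_add)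
      finally show "z\<^sup>2 * exp (- z\<^sup>2 / 8) \<le> 8" by simp
    qed auto
    finally show "\<delta> / 8 \<le> \<bar>u z\<bar>" by simp
  qed (use \<open>L > 0\<close> assms in \<open>auto simp: q_def\<close>)
  moreover have "(\<delta> / 8)\<^sup>2 * (q - (q - L)) = M + 1"
    using assms by (simp add: L_def)
  ultimately show False by simp
qed

text \<open>The comparison starts at a distant point \<open>p\<close> where \<open>h\<close> is
  smaller than \<open>\<delta>\<close>; the barrier is nonnegative there, so nothing but
  \<open>\<delta>\<close> is lost, and \<open>\<delta>\<close> is arbitrary.\<close>

lemma h_far:
  assumes "z \<le> -2" shows "\<bar>h z\<bar> \<le> 8 * K * sqrt (- z) * exp (- z\<^sup>2 / 8)"
proof (rule field_le_epsilon)
  fix \<delta> :: real assume "\<delta> > 0"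
  then obtain p where p: "p \<le> z" "\<bar>h p\<bar> < \<delta>"
    by (rule h_small_far)
  \<comment> \<open>With \<open>t = - x\<close> the derivative of \<open>h\<close> is at most
    \<open>K t^(3/2)\<close> times the Gaussian. The factor 4 would match this to leading order; 8
    doubles it, and for \<open>t \<ge> 2\<close> the surplus absorbs the term
    \<open>- 4 / sqrt t\<close> from differentiating the root.\<close>
  define b where "b x = 8 * K * sqrt (- x) * exp (- x\<^sup>2 / 8)" for x
  define b' where "b' x = K * exp (- x\<^sup>2 / 8) * (2 * (- x) * sqrt (- x) - 4 / sqrt (- x))" for x
  have "\<bar>h z - h p\<bar> \<le> b z - b p"
  proof (rule DERIV_compare[OF p(1)])
    fix x assume "p \<le> x" "x \<le> z"
    then have x: "x \<le> -2" "x < 0" using assms by auto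
    show "(h has_real_derivative - (x * exp (- x\<^sup>2 / 8)) * G x) (at x)"
      by (rule h[OF x(2)])
    show "(b has_real_derivative b' x) (at x)"
      unfolding b_def[abs_def] b'_def using x
      by (auto intro!: derivative_eq_intros simp: field_simps)
    define t where "t = - x"
    define s where "s = sqrt t"
    have t: "t \<ge> 2" "s > 0" "s * s = t"
      using x by (auto simp: t_def s_def)
    have "4 \<le> t * t"
      using mult_mono[of 2 t 2 t] t by simp
    then have "4 / s \<le> t * s"
      using t by (simp add: pos_divide_le_eq mult.assoc)
    then have "t * s \<le> 2 * t * s - 4 / s"
      by (simp add: mult.commute)
    then have "K * exp (- x\<^sup>2 / 8) * (t * s) \<le> b' x"
      unfolding b'_def t_def[symmetric] s_def[symmetric]
      using K_nonneg by (intro mult_left_mono) auto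
    moreover have "\<bar>- (x * exp (- x\<^sup>2 / 8)) * G x\<bar> = t * exp (- x\<^sup>2 / 8) * \<bar>G x\<bar>"
      using x by (simp add: abs_mult t_def)
    moreover have "\<dots> \<le> t * exp (- x\<^sup>2 / 8) * (K * s)"
      using G_growth[of x] x t by (intro mult_left_mono) (auto simp: s_def t_def mult_nonpos_nonneg)
    ultimately show "\<bar>- (x * exp (- x\<^sup>2 / 8)) * G x\<bar> \<le> b' x"
      by (simp add: mult_ac)
  qed
  moreover have "b p \<ge> 0"
    using K_nonneg p assms by (auto simp: b_def)
  ultimately show "\<bar>h z\<bar> \<le> 8 * K * sqrt (- z) * exp (- z\<^sup>2 / 8) + \<delta>"
    using p(2) unfolding b_def by linarith
qed

lemma u_far:
  assumes "z \<le> -2" shows "z\<^sup>2 * \<bar>u z\<bar> \<le> 8 * K * sqrt (- z)"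
proof -
  have "exp (- z\<^sup>2 / 8) * (z\<^sup>2 * \<bar>u z\<bar>) = \<bar>h z\<bar>"
    using assms by (simp add: h_eq abs_mult)
  also have "\<dots> \<le> exp (- z\<^sup>2 / 8) * (8 * K * sqrt (- z))"
    using h_far[OF assms] by (simp add: mult_ac)
  finally show ?thesis by simp
qed

text \<open>Near 0 the derivative of \<open>h\<close> differs from \<open>- G(0) z\<close> by at
  most \<open>\<epsilon> \<bar>z\<bar>\<close>, whose primitive is the barrier. The constant of
  integration is controlled at a point \<open>q\<close> between \<open>z\<close> and 0 where
  \<open>h\<close> is as small as desired.\<close>

lemma h_near_0:
  assumes "\<epsilon> > 0"
  obtains d where "d > 0" "\<And>z. - d < z \<Longrightarrow> z < 0 \<Longrightarrow> \<bar>h z + G 0 * z\<^sup>2 / 2\<bar> \<le> \<epsilon> * z\<^sup>2 / 2"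
proof -
  have "continuous_on {..0} (\<lambda>z. exp (- z\<^sup>2 / 8) * G z)"
    by (intro continuous_intros G) auto
  then obtain d where d: "d > 0"
    "\<And>z. z \<in> {..0} \<Longrightarrow> dist z 0 < d \<Longrightarrow> dist (exp (- z\<^sup>2 / 8) * G z) (exp (- 0\<^sup>2 / 8) * G 0) < \<epsilon>"
    using \<open>\<epsilon> > 0\<close> unfolding continuous_on_iff by (metis atMost_iff order_refl)
  have G_near: "\<bar>exp (- z\<^sup>2 / 8) * G z - G 0\<bar> \<le> \<epsilon>" if "- d < z" "z < 0" for z
    using d(2)[of z] that by (simp add: dist_real_def)
  show thesis
  proof (rule that[OF d(1)])
    fix z assume z: "- d < z" "z < 0"
    show "\<bar>h z + G 0 * z\<^sup>2 / 2\<bar> \<le> \<epsilon> * z\<^sup>2 / 2"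
    proof (rule field_le_epsilon)
      fix \<delta> :: real assume "\<delta> > 0"
      \<comment> \<open>The three bounds place \<open>q\<close> to the right of \<open>z\<close>,
        give \<open>q^2 \<le> r\<close>, and keep \<open>G(0) q^2 / 2\<close> below
        \<open>\<delta> / 2\<close>; the other half of \<open>\<delta>\<close> is spent on
        \<open>h q\<close>.\<close>
      define r where "r = min (min (- z) 1) (\<delta> / (\<bar>G 0\<bar> + 1))"
      have r: "r > 0" "r \<le> - z" "r \<le> 1" "r \<le> \<delta> / (\<bar>G 0\<bar> + 1)"
        using z \<open>\<delta> > 0\<close> by (auto simp: r_def)
      obtain q where q: "- r < q" "q < 0" "\<bar>h q\<bar> < \<delta> / 2"
        using h_small_near_0[of "\<delta> / 2" r] r \<open>\<delta> > 0\<close> by (metis half_gt_zero)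
      have "z \<le> q" using q r by simp
      have "\<bar>(h q + G 0 * q\<^sup>2 / 2) - (h z + G 0 * z\<^sup>2 / 2)\<bar> \<le> - \<epsilon> * q\<^sup>2 / 2 - - \<epsilon> * z\<^sup>2 / 2"
      proof (rule DERIV_compare[OF \<open>z \<le> q\<close>, where y' = "\<lambda>x. - (x * exp (- x\<^sup>2 / 8)) * G x + G 0 * x"
            and b' = "\<lambda>x. - \<epsilon> * x"])
        fix x assume "z \<le> x" "x \<le> q"
        then have x: "- d < x" "x < 0" using z q by auto
        show "((\<lambda>x. h x + G 0 * x\<^sup>2 / 2) has_real_derivative - (x * exp (- x\<^sup>2 / 8)) * G x + G 0 * x) (at x)"
          using x by (auto intro!: derivative_eq_intros h)
        show "((\<lambda>x. - \<epsilon> * x\<^sup>2 / 2) has_real_derivative - \<epsilon> * x) (at x)"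
          by (auto intro!: derivative_eq_intros)
        have "- (x * exp (- x\<^sup>2 / 8)) * G x + G 0 * x = (- x) * (exp (- x\<^sup>2 / 8) * G x - G 0)"
          by (simp add: algebra_simps)
        then have "\<bar>- (x * exp (- x\<^sup>2 / 8)) * G x + G 0 * x\<bar> = (- x) * \<bar>exp (- x\<^sup>2 / 8) * G x - G 0\<bar>"
          using x by (simp add: abs_mult)
        also have "\<dots> \<le> (- x) * \<epsilon>"
          using G_near[OF x] x by (intro mult_left_mono) auto
        finally show "\<bar>- (x * exp (- x\<^sup>2 / 8)) * G x + G 0 * x\<bar> \<le> - \<epsilon> * x"
          by (simp add: mult_ac)
      qed
      moreover have "\<epsilon> * q\<^sup>2 \<ge> 0" using \<open>\<epsilon> > 0\<close> by simp
      moreover have "\<bar>G 0 * q\<^sup>2 / 2\<bar> \<le> \<delta> / 2"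
      proof -
        have "q\<^sup>2 \<le> r"
          using q r mult_mono[of "- q" r "- q" 1] by (simp add: power2_eq_square)
        then have "\<bar>G 0\<bar> * q\<^sup>2 \<le> (\<bar>G 0\<bar> + 1) * (\<delta> / (\<bar>G 0\<bar> + 1))"
          using r by (intro mult_mono) auto
        also have "\<dots> = \<delta>" by simp
        finally show ?thesis by (simp add: abs_mult)
      qed
      ultimately show "\<bar>h z + G 0 * z\<^sup>2 / 2\<bar> \<le> \<epsilon> * z\<^sup>2 / 2 + \<delta>"
        using q(3) by linarith
    qed
  qed
qed

lemma u_limit_0: "(u \<longlongrightarrow> - G 0 / 2) (at_left 0)"
proof -
  have "((\<lambda>z. (h z + G 0 * z\<^sup>2 / 2) / z\<^sup>2) \<longlongrightarrow> 0) (at_left 0)"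
  proof (rule tendstoI)
    fix \<epsilon> :: real assume "\<epsilon> > 0"
    then obtain d where d: "d > 0" "\<And>z. - d < z \<Longrightarrow> z < 0 \<Longrightarrow> \<bar>h z + G 0 * z\<^sup>2 / 2\<bar> \<le> \<epsilon> * z\<^sup>2 / 2"
      by (rule h_near_0) blast
    show "\<forall>\<^sub>F z in at_left 0. dist ((h z + G 0 * z\<^sup>2 / 2) / z\<^sup>2) 0 < \<epsilon>"
    proof (rule eventually_at_leftI)
      fix z assume z: "z \<in> {- d<..<0}"
      then have "0 < \<epsilon> * z\<^sup>2"
        using \<open>\<epsilon> > 0\<close> by simp
      moreover have "\<bar>h z + G 0 * z\<^sup>2 / 2\<bar> \<le> \<epsilon> * z\<^sup>2 / 2"
        using z by (intro d(2)) auto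
      ultimately have "\<bar>h z + G 0 * z\<^sup>2 / 2\<bar> < \<epsilon> * z\<^sup>2"
        by linarith
      then show "dist ((h z + G 0 * z\<^sup>2 / 2) / z\<^sup>2) 0 < \<epsilon>"
        using z by (simp add: dist_real_def abs_divide divide_less_eq)
    qed (use d in auto)
  qed
  moreover have "((\<lambda>z::real. exp (z\<^sup>2 / 8)) \<longlongrightarrow> exp (0\<^sup>2 / 8)) (at_left 0)"
    by (intro tendsto_intros) auto
  ultimately have "((\<lambda>z. exp (z\<^sup>2 / 8) * ((h z + G 0 * z\<^sup>2 / 2) / z\<^sup>2 - G 0 / 2)) \<longlongrightarrow> exp (0\<^sup>2 / 8) * (0 - G 0 / 2)) (at_left 0)"
    by (intro tendsto_mult tendsto_diff tendsto_const)
  moreover have "\<forall>\<^sub>F z in at_left 0. exp (z\<^sup>2 / 8) * ((h z + G 0 * z\<^sup>2 / 2) / z\<^sup>2 - G 0 / 2) = u z"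
    by (rule eventually_at_leftI[of "-1"]) (auto simp: u field_simps)
  ultimately show ?thesis
    using tendsto_cong by force
qed

section \<open>The energy density and its identities on compact intervals\<close>

definition u' where "u' z = z * u z / 4 - 2 * u z / z - G z / z"

text \<open>\<open>u'\<close> is the equation \<open>z u' + 2 u - z^2 u / 4 = - G\<close> solved for
  the derivative. Its continuity on the open half-line is then inherited from \<open>u\<close> and
  \<open>G\<close>.\<close>

lemma DERIV_u:
  assumes "z < 0" shows "(u has_real_derivative u' z) (at z)"
proof -
  have "((\<lambda>z. h z * exp (z\<^sup>2 / 8) / z\<^sup>2) has_real_derivative u' z) (at z)"
  proof -
    have e: "exp (- z\<^sup>2 / 8) * exp (z\<^sup>2 / 8) = 1"
      by (simp flip: exp_add)
    have "((\<lambda>z. h z * (exp (z\<^sup>2 / 8) / z\<^sup>2)) has_real_derivative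
      h z * (exp (z\<^sup>2 / 8) / z\<^sup>2) * (z / 4 - 2 / z) - exp (- z\<^sup>2 / 8) * exp (z\<^sup>2 / 8) * (G z / z)) (at z)"
      using assms by (auto intro!: derivative_eq_intros h simp: field_simps power2_eq_square)
    then show ?thesis
      unfolding e using assms by (simp add: u'_def u field_simps)
  qed
  then show ?thesis
    by (rule has_field_derivative_transform_within_open[of _ _ _ "{..<0}"]) (use assms u in auto)
qed

lemma u_continuous: "continuous_on {..<0} u"
  using DERIV_u by (auto intro!: continuous_at_imp_continuous_on DERIV_isCont)

lemma u'_continuous: "continuous_on {..<0} u'"
proof -
  have "continuous_on {..<0} G"
    by (rule continuous_on_subset[OF G]) auto
  then show ?thesis
    unfolding u'_def[abs_def] by (intro continuous_intros u_continuous) auto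
qed

definition energy where "energy z = z * (u' z)\<^sup>2 + 1 / 4 * z * (u z)\<^sup>2"

definition bdry where "bdry z = G z * u z + (u z)\<^sup>2 - z\<^sup>2 * (u z)\<^sup>2 / 8"

lemma energy_continuous: "continuous_on {..<0} energy"
  unfolding energy_def[abs_def] by (intro continuous_intros u_continuous u'_continuous)

text \<open>Integration by parts leaves \<open>- G u'\<close>. Substituting the equation for
  \<open>G\<close> turns this into \<open>z (u')^2 + 2 u u' - z^2 u u' / 4\<close>, which is the
  energy density plus the derivative of \<open>u^2 - z^2 u^2 / 8\<close>.\<close>

lemma energy_identity:
  assumes pq: "p \<le> q" "q < 0" and f: "primitive_on {..<0} f G"
  shows "integral {p..q} (\<lambda>z. f z * u z) = bdry q - bdry p + integral {p..q} energy"
proof -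
  have sub: "{p..q} \<subseteq> {..<0}" using pq by auto
  note cont = continuous_on_subset[OF _ sub]
  have D: "(u has_real_derivative u' z) (at z within S)" if "z \<in> {p..q}" for z S
    using DERIV_u[of z] that pq has_field_derivative_at_within by force
  have "integral {p..q} (\<lambda>z. f z * u z) = G q * u q - G p * u p - integral {p..q} (\<lambda>z. G z * u' z)"
    by (rule primitive_by_parts[OF pq(1) primitive_on_subset[OF f sub] D cont[OF u'_continuous]])
  moreover have "((\<lambda>z. - (G z * u' z) - energy z) has_integral
      ((u q)\<^sup>2 - q\<^sup>2 * (u q)\<^sup>2 / 8) - ((u p)\<^sup>2 - p\<^sup>2 * (u p)\<^sup>2 / 8)) {p..q}"
  proof (rule fundamental_theorem_of_calculus[OF pq(1)])
    fix z assume z: "z \<in> {p..q}"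
    then have "z \<noteq> 0" using pq by auto
    then have "- G z = z * u' z + 2 * u z - z\<^sup>2 * u z / 4"
      by (simp add: u'_def field_simps power2_eq_square)
    then have "- (G z * u' z) = (z * u' z + 2 * u z - z\<^sup>2 * u z / 4) * u' z"
      by (metis mult_minus_left)
    then have eq: "- (G z * u' z) - energy z = 2 * u z * u' z - (2 * z * (u z)\<^sup>2 + z\<^sup>2 * (2 * u z * u' z)) / 8"
      by (simp add: energy_def field_simps power2_eq_square)
    have "((\<lambda>z. (u z)\<^sup>2 - z\<^sup>2 * (u z)\<^sup>2 / 8) has_real_derivative - (G z * u' z) - energy z) (at z within {p..q})"
      unfolding eq by (auto intro!: derivative_eq_intros D z simp: field_simps)
    then show "((\<lambda>z. (u z)\<^sup>2 - z\<^sup>2 * (u z)\<^sup>2 / 8) has_vector_derivative - (G z * u' z) - energy z) (at z within {p..q})"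
      by (simp add: has_real_derivative_iff_has_vector_derivative)
  qed
  moreover have "energy integrable_on {p..q}"
    by (rule integrable_continuous_real[OF cont[OF energy_continuous]])
  moreover have "(\<lambda>z. G z * u' z) integrable_on {p..q}"
    by (intro integrable_continuous_real continuous_intros cont[OF u'_continuous]
        continuous_on_subset[OF G]) (use pq in auto)
  ultimately show ?thesis
    using integral_diff[of "\<lambda>z. - (G z * u' z)" "{p..q}" energy]
    by (simp add: bdry_def integral_unique integrable_neg integral_neg)
qed

lemma energy_le:
  assumes pq: "p \<le> q" "q < 0"
  shows "integral {p..q} energy \<le> q * (u q)\<^sup>2 / 2 - p * (u p)\<^sup>2 / 2 - 1 / 2 * integral {p..q} (\<lambda>z. (u z)\<^sup>2)"
proof -
  have sub: "{p..q} \<subseteq> {..<0}" using pq by auto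
  note cont = continuous_on_subset[OF _ sub]
  have D: "(u has_real_derivative u' z) (at z within S)" if "z \<in> {p..q}" for z S
    using DERIV_u[of z] that pq has_field_derivative_at_within by force
  have E: "energy integrable_on {p..q}"
    by (rule integrable_continuous_real[OF cont[OF energy_continuous]])
  have U: "(\<lambda>z. (u z)\<^sup>2) integrable_on {p..q}"
    by (rule integrable_on_subinterval[OF u_square sub])
  have I: "((\<lambda>z. (u z)\<^sup>2 / 2 + z * u z * u' z) has_integral q * (u q)\<^sup>2 / 2 - p * (u p)\<^sup>2 / 2) {p..q}"
  proof (rule fundamental_theorem_of_calculus[OF pq(1)])
    fix z assume z: "z \<in> {p..q}"
    have "((\<lambda>z. z * (u z)\<^sup>2 / 2) has_real_derivative (u z)\<^sup>2 / 2 + z * u z * u' z) (at z within {p..q})"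
      by (auto intro!: derivative_eq_intros D z simp: field_simps)
    then show "((\<lambda>z. z * (u z)\<^sup>2 / 2) has_vector_derivative (u z)\<^sup>2 / 2 + z * u z * u' z) (at z within {p..q})"
      by (simp add: has_real_derivative_iff_has_vector_derivative)
  qed
  have "integral {p..q} energy + 1 / 2 * integral {p..q} (\<lambda>z. (u z)\<^sup>2)
      = integral {p..q} (\<lambda>z. energy z + 1 / 2 * (u z)\<^sup>2)"
    using E U by (subst integral_add) (simp_all add: integrable_on_divide)
  also have "\<dots> \<le> integral {p..q} (\<lambda>z. (u z)\<^sup>2 / 2 + z * u z * u' z)"
  proof (rule integral_le)
    show "(\<lambda>z. energy z + 1 / 2 * (u z)\<^sup>2) integrable_on {p..q}"
      by (intro integrable_add E integrable_on_mult_right U)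
    show "(\<lambda>z. (u z)\<^sup>2 / 2 + z * u z * u' z) integrable_on {p..q}"
      using I by blast
    fix z assume "z \<in> {p..q}"
    then have "z * (u' z - u z / 2)\<^sup>2 \<le> 0"
      using pq by (intro mult_nonpos_nonneg) auto
    then show "energy z + 1 / 2 * (u z)\<^sup>2 \<le> (u z)\<^sup>2 / 2 + z * u z * u' z"
      by (simp add: energy_def field_simps power2_eq_square)
  qed
  also have "\<dots> = q * (u q)\<^sup>2 / 2 - p * (u p)\<^sup>2 / 2"
    by (rule integral_unique[OF I])
  finally show ?thesis by simp
qed

text \<open>With \<open>t = - z\<close>, squaring \<open>u_far\<close> bounds \<open>z^2 u^2\<close>
  by \<open>64 K^2 / t\<close>, and \<open>G u\<close> is at most \<open>8 K^2 / t\<close> because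
  the decay of \<open>u\<close> outweighs the growth of \<open>G\<close>. The three terms of
  \<open>bdry\<close> add up to \<open>8 + 64 + 64 / 8 = 80\<close>.\<close>

lemma u_limit_far:
  "((\<lambda>z. z * (u z)\<^sup>2) \<longlongrightarrow> 0) at_bot" "(bdry \<longlongrightarrow> 0) at_bot"
proof -
  have bounds: "\<bar>z * (u z)\<^sup>2\<bar> \<le> 64 * K\<^sup>2 / (- z) \<and> \<bar>bdry z\<bar> \<le> 80 * K\<^sup>2 / (- z)" if "z \<le> -2" for z
  proof -
    define t where "t = - z"
    have t: "t \<ge> 2" "z\<^sup>2 = t\<^sup>2" "sqrt t * sqrt t = t"
      using that by (auto simp: t_def)
    have a: "t\<^sup>2 * \<bar>u z\<bar> \<le> 8 * K * sqrt t"
      using u_far[OF that] by (simp add: t_def)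
    have "(t\<^sup>2 * \<bar>u z\<bar>)\<^sup>2 \<le> (8 * K * sqrt t)\<^sup>2"
      by (rule power_mono[OF a]) simp
    also have "\<dots> = 64 * K\<^sup>2 * t"
      using t by (simp add: power_mult_distrib)
    finally have "t * (t * (z\<^sup>2 * (u z)\<^sup>2)) \<le> t * (64 * K\<^sup>2)"
      using t by (simp add: power_mult_distrib power2_eq_square mult_ac)
    then have zu: "z\<^sup>2 * (u z)\<^sup>2 \<le> 64 * K\<^sup>2 / t"
      using t by (simp add: field_simps)
    have "t \<le> t\<^sup>2"
      using t by (simp add: power2_eq_square)
    then have "1 * (u z)\<^sup>2 \<le> z\<^sup>2 * (u z)\<^sup>2" "t * (u z)\<^sup>2 \<le> t\<^sup>2 * (u z)\<^sup>2"
      using t by (intro mult_right_mono; simp)+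
    then have u2: "(u z)\<^sup>2 \<le> 64 * K\<^sup>2 / t" "t * (u z)\<^sup>2 \<le> 64 * K\<^sup>2 / t"
      using zu t by auto
    have "\<bar>G z * u z\<bar> \<le> 8 * K\<^sup>2 / t"
    proof -
      have "t\<^sup>2 * \<bar>G z * u z\<bar> = \<bar>G z\<bar> * (t\<^sup>2 * \<bar>u z\<bar>)"
        by (simp add: abs_mult)
      also have "\<dots> \<le> (K * sqrt t) * (8 * K * sqrt t)"
      proof (rule mult_mono)
        show "\<bar>G z\<bar> \<le> K * sqrt t"
          using G_growth[of z] that by (simp add: t_def)
        show "0 \<le> K * sqrt t"
          using K_nonneg t by simp
      qed (use a in auto)
      also have "\<dots> = t * (8 * K\<^sup>2)"
        using t by (simp add: power2_eq_square mult_ac)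
      finally show ?thesis
        using t by (simp add: power2_eq_square field_simps)
    qed
    then have "\<bar>bdry z\<bar> \<le> 8 * K\<^sup>2 / t + 64 * K\<^sup>2 / t + (64 * K\<^sup>2 / t) / 8"
      unfolding bdry_def using zu u2 zero_le_power2[of "u z"] mult_nonneg_nonneg[of "z\<^sup>2" "(u z)\<^sup>2"]
      by (intro order_trans[OF abs_triangle_ineq4] add_mono order_trans[OF abs_triangle_ineq]) auto
    moreover have "\<bar>z * (u z)\<^sup>2\<bar> = t * (u z)\<^sup>2"
      using that by (simp add: t_def abs_mult)
    ultimately show ?thesis
      using u2 by (simp add: t_def)
  qed
  have lim: "((\<lambda>z. C / (- z)) \<longlongrightarrow> 0) at_bot" for C :: real
    by (rule tendsto_divide_0[OF tendsto_const filterlim_at_top_imp_at_infinity[OF filterlim_uminus_at_top_at_bot]])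
  have ev: "eventually (\<lambda>z::real. z \<le> -2) at_bot"
    by (rule eventually_le_at_bot)
  show "((\<lambda>z. z * (u z)\<^sup>2) \<longlongrightarrow> 0) at_bot" "(bdry \<longlongrightarrow> 0) at_bot"
    by (rule Lim_null_comparison[OF _ lim], rule eventually_mono[OF ev], use bounds in auto)+
qed

end

section \<open>Passage to the half-line\<close>

text \<open>The shifts by 2 and 1 make already the first interval, from \<open>- 2\<close> to
  \<open>- 1\<close>, nondegenerate and avoid a division by zero.\<close>

definition exhaustion :: "nat \<Rightarrow> real set" where
  "exhaustion n = {- (real n + 2)..- (1 / (real n + 1))}"

lemma exhaustion_subset: "exhaustion n \<subseteq> {..<0}"
  by (auto simp: exhaustion_def intro: order_le_less_trans)

lemma exhaustion_mono: "exhaustion n \<subseteq> exhaustion (Suc n)"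
proof -
  have "1 / (real (Suc n) + 1) \<le> 1 / (real n + 1)"
    by (intro divide_left_mono) auto
  then show ?thesis
    by (auto simp: exhaustion_def)
qed

lemma exhaustion_eventually:
  assumes "x < 0" shows "eventually (\<lambda>n. x \<in> exhaustion n) sequentially"
proof -
  obtain N where N: "real N > max (- x) (1 / (- x))"
    using reals_Archimedean2 by blast
  show ?thesis
  proof (rule eventually_sequentiallyI)
    fix n assume "N \<le> n"
    then have n: "- x < real n" "1 / (- x) < real n + 1"
      using N by auto
    then have "1 < (real n + 1) * (- x)"
      using assms by (subst (asm) pos_divide_less_eq) auto
    then have "1 / (real n + 1) < - x"
      by (subst pos_divide_less_eq) (auto simp: mult.commute)
    then show "x \<in> exhaustion n"
      using n by (auto simp: exhaustion_def)
  qed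
qed

lemma exhaustion_pointwise:
  fixes \<phi> :: "real \<Rightarrow> real"
  assumes "x < 0"
  shows "(\<lambda>n. if x \<in> exhaustion n then \<phi> x else 0) \<longlonglongrightarrow> \<phi> x"
  by (rule tendsto_eventually, rule eventually_mono[OF exhaustion_eventually[OF assms]]) simp

lemma exhaustion_integral:
  fixes \<phi> :: "real \<Rightarrow> real"
  assumes "(\<phi> has_integral I) (exhaustion n)"
  shows "((\<lambda>x. if x \<in> exhaustion n then \<phi> x else 0) has_integral I) {..<0}"
  using assms has_integral_restrict[OF exhaustion_subset] by blast

lemma exhaustion_integral_tendsto:
  fixes \<phi> :: "real \<Rightarrow> real"
  assumes "\<phi> absolutely_integrable_on {..<0}"
  shows "(\<lambda>n. integral (exhaustion n) \<phi>) \<longlonglongrightarrow> integral {..<0} \<phi>"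
proof -
  let ?f = "\<lambda>n x. if x \<in> exhaustion n then \<phi> x else 0"
  have "\<phi> integrable_on exhaustion n" for n
    using absolutely_integrable_imp_integrable_on[OF assms] exhaustion_subset[of n]
    unfolding exhaustion_def by (rule integrable_on_subinterval)
  then have I: "(?f n has_integral integral (exhaustion n) \<phi>) {..<0}" for n
    by (intro exhaustion_integral integrable_integral)
  have "(\<lambda>n. integral {..<0} (?f n)) \<longlonglongrightarrow> integral {..<0} \<phi>"
  proof (rule dominated_convergence(2))
    show "?f n integrable_on {..<0}" for n
      using I by blast
    show "(\<lambda>x. \<bar>\<phi> x\<bar>) integrable_on {..<0}"
      using assms unfolding absolutely_integrable_on_def real_norm_def by simp
    show "(\<lambda>n. ?f n x) \<longlonglongrightarrow> \<phi> x" if "x \<in> {..<0}" for x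
      using that by (intro exhaustion_pointwise) simp
  qed auto
  then show ?thesis
    by (simp only: integral_unique[OF I])
qed

lemma exhaustion_ends:
  "filterlim (\<lambda>n. - (1 / (real n + 1))) (at_left 0) sequentially"
  "filterlim (\<lambda>n. - (real n + 2)) at_bot sequentially"
proof -
  have "(\<lambda>n. - (1 / (real n + 1))) \<longlonglongrightarrow> - 0"
    using LIMSEQ_Suc[OF lim_1_over_n] by (intro tendsto_minus) (simp add: add.commute)
  then show "filterlim (\<lambda>n. - (1 / (real n + 1))) (at_left 0) sequentially"
    unfolding filterlim_at by (auto intro!: always_eventually)
  have "filterlim (\<lambda>n. 2 + real n) at_top sequentially"
    by (rule filterlim_tendsto_add_at_top[OF tendsto_const filterlim_real_sequentially])
  then show "filterlim (\<lambda>n. - (real n + 2)) at_bot sequentially"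
    by (simp add: filterlim_uminus_at_top add.commute)
qed

context square_integrable_solution
begin

lemma exhaustion_ends_le: "- (real n + 2) \<le> - (1 / (real n + 1))" "- (1 / (real n + 1)) < 0"
proof -
  have "1 / (real n + 1) \<le> 1" by simp
  then show "- (real n + 2) \<le> - (1 / (real n + 1))"
    using of_nat_0_le_iff[of n] by linarith
qed simp

lemma energy_nonpos:
  assumes "z < 0" shows "energy z \<le> 0"
proof -
  have "z * ((u' z)\<^sup>2 + (u z)\<^sup>2 / 4) \<le> 0"
    using assms by (intro mult_nonpos_nonneg) auto
  then show ?thesis
    by (simp add: energy_def algebra_simps)
qed

text \<open>Every other term of \<open>energy_identity\<close> converges along the exhaustion, so
  the integrals of the nonnegative function \<open>- energy\<close> do as well. Monotone convergence
  yields integrability and the value at once.\<close>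

lemma energy_has_integral:
  assumes f: "primitive_on {..<0} f G"
    and fu: "(\<lambda>z. f z * u z) absolutely_integrable_on {..<0}"
  shows "(energy has_integral (integral {..<0} (\<lambda>z. f z * u z) + (G 0)\<^sup>2 / 4)) {..<0}"
proof -
  define p q where "p n = - (real n + 2)" and "q n = - (1 / (real n + 1))" for n
  have pq: "p n \<le> q n" "q n < 0" and ex: "exhaustion n = {p n..q n}" for n
    using exhaustion_ends_le[of n] by (simp_all add: p_def q_def exhaustion_def)
  have q: "filterlim q (at_left 0) sequentially" and p: "filterlim p at_bot sequentially"
    using exhaustion_ends by (simp_all add: p_def[abs_def] q_def[abs_def])
  have G0: "(G \<longlongrightarrow> G 0) (at_left 0)"
  proof (rule tendsto_within_subset)
    show "(G \<longlongrightarrow> G 0) (at 0 within {..0})"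
      using G unfolding continuous_on_def by simp
  qed auto
  \<comment> \<open>Since \<open>u\<close> tends to \<open>- G(0) / 2\<close>, the limit is
    \<open>- G(0)^2 / 2 + G(0)^2 / 4\<close>, that is minus the square of the boundary
    value.\<close>
  have "((\<lambda>z. G z * u z + (u z)\<^sup>2 - z\<^sup>2 * (u z)\<^sup>2 / 8) \<longlongrightarrow>
      G 0 * (- G 0 / 2) + (- G 0 / 2)\<^sup>2 - 0\<^sup>2 * (- G 0 / 2)\<^sup>2 / 8) (at_left 0)"
    by (intro tendsto_intros G0 u_limit_0) auto
  then have "(bdry \<longlongrightarrow> - (G 0)\<^sup>2 / 4) (at_left 0)"
    by (simp add: bdry_def[abs_def] power2_eq_square field_simps)
  then have "(\<lambda>n. bdry (q n)) \<longlonglongrightarrow> - (G 0)\<^sup>2 / 4"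
    using q by (rule filterlim_compose)
  moreover have "(\<lambda>n. bdry (p n)) \<longlonglongrightarrow> 0"
    by (rule filterlim_compose[OF u_limit_far(2) p])
  ultimately have "(\<lambda>n. integral (exhaustion n) (\<lambda>z. f z * u z) - bdry (q n) + bdry (p n))
      \<longlonglongrightarrow> integral {..<0} (\<lambda>z. f z * u z) - (- (G 0)\<^sup>2 / 4) + 0"
    by (intro tendsto_add tendsto_diff exhaustion_integral_tendsto[OF fu])
  then have lim: "(\<lambda>n. - integral (exhaustion n) energy) \<longlonglongrightarrow> - (integral {..<0} (\<lambda>z. f z * u z) + (G 0)\<^sup>2 / 4)"
    using energy_identity[OF pq f] by (intro tendsto_minus) (simp add: ex)
  have "((\<lambda>z. - energy z) has_integral - (integral {..<0} (\<lambda>z. f z * u z) + (G 0)\<^sup>2 / 4)) {..<0}"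
  proof (rule has_integral_monotone_convergence_increasing[OF _ _ _ lim])
    show "((\<lambda>x. if x \<in> exhaustion n then - energy x else 0) has_integral - integral (exhaustion n) energy) {..<0}" for n
    proof (intro exhaustion_integral has_integral_neg integrable_integral)
      show "energy integrable_on exhaustion n"
        using continuous_on_subset[OF energy_continuous exhaustion_subset[of n]]
        unfolding exhaustion_def by (rule integrable_continuous_real)
    qed
    show "(if x \<in> exhaustion n then - energy x else 0) \<le> (if x \<in> exhaustion (Suc n) then - energy x else 0)"
      if "x \<in> {..<0}" for n x
      using exhaustion_mono[of n] energy_nonpos[of x] that by auto
    show "(\<lambda>n. if x \<in> exhaustion n then - energy x else 0) \<longlonglongrightarrow> - energy x" if "x \<in> {..<0}" for x
      using that by (intro exhaustion_pointwise) simp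
  qed
  from has_integral_neg[OF this] show ?thesis
    by (simp add: add.commute)
qed

lemma energy_absolutely_integrable:
  assumes "energy integrable_on {..<0}"
  shows "energy absolutely_integrable_on {..<0}"
proof -
  have "(\<lambda>z. norm (energy z)) integrable_on {..<0}"
    by (rule integrable_eq[OF integrable_neg[OF assms]]) (use energy_nonpos in auto)
  then show ?thesis
    using assms by (simp add: absolutely_integrable_on_def)
qed

text \<open>The boundary terms \<open>z u^2 / 2\<close> of \<open>energy_le\<close> vanish at both
  ends: at 0 because \<open>u\<close> has a finite limit, at the far end by its decay.\<close>

lemma energy_integral_le:
  assumes "(energy has_integral L) {..<0}"
  shows "L \<le> - (1 / 2) * M"
proof -
  define p q where "p n = - (real n + 2)" and "q n = - (1 / (real n + 1))" for n
  have pq: "p n \<le> q n" "q n < 0" and ex: "exhaustion n = {p n..q n}" for n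
    using exhaustion_ends_le[of n] by (simp_all add: p_def q_def exhaustion_def)
  have q: "filterlim q (at_left 0) sequentially" and p: "filterlim p at_bot sequentially"
    using exhaustion_ends by (simp_all add: p_def[abs_def] q_def[abs_def])
  have E: "energy absolutely_integrable_on {..<0}"
    using assms by (intro energy_absolutely_integrable) blast
  have U: "(\<lambda>z. (u z)\<^sup>2) absolutely_integrable_on {..<0}"
    using u_square by (intro nonnegative_absolutely_integrable_1) auto
  have "((\<lambda>z. z * (u z)\<^sup>2) \<longlongrightarrow> 0 * (- G 0 / 2)\<^sup>2) (at_left 0)"
    by (intro tendsto_intros u_limit_0)
  then have "((\<lambda>z. z * (u z)\<^sup>2) \<longlongrightarrow> 0) (at_left 0)"
    by simp
  then have "(\<lambda>n. q n * (u (q n))\<^sup>2) \<longlonglongrightarrow> 0"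
    using q by (rule filterlim_compose)
  moreover have "(\<lambda>n. p n * (u (p n))\<^sup>2) \<longlonglongrightarrow> 0"
    by (rule filterlim_compose[OF u_limit_far(1) p])
  ultimately have "(\<lambda>n. q n * (u (q n))\<^sup>2 / 2 - p n * (u (p n))\<^sup>2 / 2 - 1 / 2 * integral (exhaustion n) (\<lambda>z. (u z)\<^sup>2))
      \<longlonglongrightarrow> 0 / 2 - 0 / 2 - 1 / 2 * M"
    unfolding M_def by (intro tendsto_diff tendsto_divide tendsto_mult tendsto_const exhaustion_integral_tendsto[OF U]) auto
  moreover have "integral (exhaustion n) energy
      \<le> q n * (u (q n))\<^sup>2 / 2 - p n * (u (p n))\<^sup>2 / 2 - 1 / 2 * integral (exhaustion n) (\<lambda>z. (u z)\<^sup>2)" for n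
    using energy_le[OF pq[of n]] by (simp add: ex)
  ultimately have "integral {..<0} energy \<le> 0 / 2 - 0 / 2 - 1 / 2 * M"
    using LIMSEQ_le[OF exhaustion_integral_tendsto[OF E]] by blast
  then show ?thesis
    using integral_unique[OF assms] by simp
qed

end

theorem lemma6p1:
  fixes w :: "real \<Rightarrow> real"
  assumes "w \<in> Dom_H"
  shows "\<exists>u. regular_representative w u \<and>
     integrable leb_neg (\<lambda>z. z * (deriv u z)\<^sup>2 + 1 / 4 * z * (u z)\<^sup>2) \<and>
     inner_L2 (H_op w) w =
       - (u 0)\<^sup>2 + (LINT z|leb_neg. z * (deriv u z)\<^sup>2 + 1 / 4 * z * (u z)\<^sup>2) \<and>
     - (u 0)\<^sup>2 + (LINT z|leb_neg. z * (deriv u z)\<^sup>2 + 1 / 4 * z * (u z)\<^sup>2)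
       \<le> - (1 / 2) * (norm_L2 w)\<^sup>2"
proof -
  \<comment> \<open>The choice made by \<open>H_op\<close> is used only through
    \<open>represents_H w f\<close>, so the argument applies to whichever function is
    selected.\<close>
  define f where "f = H_op w"
  have w: "w \<in> L2_neg" and rep: "represents_H w f"
    using assms someI_ex[of "represents_H w"] by (auto simp: Dom_H_def f_def H_op_def)
  then have f: "f \<in> L2_neg"
    by (simp add: represents_H_def)
  obtain c h N where N: "negligible N"
    and h: "\<And>z. z < 0 \<Longrightarrow> (h has_real_derivative - (z * exp (- z\<^sup>2 / 8)) * (L2_primitive f z - c)) (at z)"
    and hw: "\<And>z. z < 0 \<Longrightarrow> z \<notin> N \<Longrightarrow> h z = z\<^sup>2 * exp (- z\<^sup>2 / 8) * w z"
    using regularity[OF w rep] by metis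
  obtain K where K: "K \<ge> 0" "\<And>z. z \<le> 0 \<Longrightarrow> \<bar>L2_primitive f z\<bar> \<le> K * sqrt (- z)"
    using L2_primitive_growth[OF f] by metis
  \<comment> \<open>Here \<open>G(0) = - c\<close>, so \<open>c / 2\<close> is the limit of
    \<open>u\<close> at 0 and makes \<open>u\<close> continuous there.\<close>
  define u where "u z = (if z < 0 then h z * exp (z\<^sup>2 / 8) / z\<^sup>2 else c / 2)" for z
  have uw: "u z = w z" if "z < 0" "z \<notin> N" for z
    using that by (simp add: u_def hw exp_minus)
  \<comment> \<open>Statements about \<open>u\<close> are transferred back to \<open>w\<close>
    through agreement off \<open>N\<close>.\<close>
  have spike: "(\<lambda>z. k z * u z) absolutely_integrable_on {..<0} \<and>
      integral {..<0} (\<lambda>z. k z * u z) = integral\<^sup>L leb_neg (\<lambda>z. k z * w z)" if k: "k \<in> L2_neg" for k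
  proof
    note kw = L2_neg_mult[OF k w]
    show "(\<lambda>z. k z * u z) absolutely_integrable_on {..<0}"
      by (rule absolutely_integrable_spike[OF kw N]) (use uw in auto)
    show "integral {..<0} (\<lambda>z. k z * u z) = integral\<^sup>L leb_neg (\<lambda>z. k z * w z)"
      unfolding integral_leb_neg(2)[OF kw] by (rule integral_spike[OF N]) (use uw in auto)
  qed
  have U: "(\<lambda>z. (u z)\<^sup>2) integrable_on {..<0}"
    by (rule integrable_spike[OF absolutely_integrable_imp_integrable_on[OF L2_neg_square[OF w]] N])
      (use uw in auto)
  define G where "G z = L2_primitive f z - c" for z
  \<comment> \<open>Subtracting \<open>c\<close> from the primitive costs
    \<open>\<bar>c\<bar>\<close>, which is at most \<open>\<bar>c\<bar> * sqrt (- z)\<close> for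
    \<open>z \<le> - 1\<close>.\<close>
  interpret square_integrable_solution u h G "K + \<bar>c\<bar>"
  proof
    show "(h has_real_derivative - (z * exp (- z\<^sup>2 / 8)) * G z) (at z)" if "z < 0" for z
      unfolding G_def by (rule h[OF that])
    show "u z = h z * exp (z\<^sup>2 / 8) / z\<^sup>2" if "z < 0" for z
      using that by (simp add: u_def)
    show "continuous_on {..0} G"
      unfolding G_def[abs_def] by (intro continuous_intros L2_primitive_continuous f)
    show "\<bar>G z\<bar> \<le> (K + \<bar>c\<bar>) * sqrt (- z)" if "z \<le> -1" for z
    proof -
      have "\<bar>G z\<bar> \<le> \<bar>L2_primitive f z\<bar> + \<bar>c\<bar> * 1"
        unfolding G_def by simp
      also have "\<dots> \<le> K * sqrt (- z) + \<bar>c\<bar> * sqrt (- z)"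
        using K(2)[of z] that by (intro add_mono mult_left_mono) auto
      finally show ?thesis by (simp add: algebra_simps)
    qed
  qed (rule U)
  have G0: "G 0 = - c" and u0: "u 0 = c / 2"
    by (simp_all add: G_def u_def)
  have prim: "primitive_on {..<0} f G"
    unfolding G_def[abs_def]
    by (rule primitive_on_diff_const, rule primitive_on_subset[OF L2_primitive[OF f]]) auto
  have fu: "(\<lambda>z. f z * u z) absolutely_integrable_on {..<0}"
    "integral {..<0} (\<lambda>z. f z * u z) = inner_L2 (H_op w) w"
    using spike[OF f] by (auto simp: inner_L2_def f_def)
  have E: "(energy has_integral inner_L2 (H_op w) w + (u 0)\<^sup>2) {..<0}"
    using energy_has_integral[OF prim fu(1)] by (simp add: fu(2) G0 u0 power_divide)
  have Ea: "energy absolutely_integrable_on {..<0}"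
    using E by (intro energy_absolutely_integrable) blast
  have deriv: "z * (deriv u z)\<^sup>2 + 1 / 4 * z * (u z)\<^sup>2 = energy z" if "z \<in> space leb_neg" for z
    using that DERIV_imp_deriv[OF DERIV_u[of z]] by (simp add: energy_def)
  have "integrable leb_neg (\<lambda>z. z * (deriv u z)\<^sup>2 + 1 / 4 * z * (u z)\<^sup>2) = integrable leb_neg energy"
    by (rule Bochner_Integration.integrable_cong[OF refl deriv])
  then have int: "integrable leb_neg (\<lambda>z. z * (deriv u z)\<^sup>2 + 1 / 4 * z * (u z)\<^sup>2)"
    using integral_leb_neg(1)[OF Ea] by simp
  have "(LINT z|leb_neg. z * (deriv u z)\<^sup>2 + 1 / 4 * z * (u z)\<^sup>2) = integral\<^sup>L leb_neg energy"
    by (rule Bochner_Integration.integral_cong[OF refl deriv])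
  then have LINT: "(LINT z|leb_neg. z * (deriv u z)\<^sup>2 + 1 / 4 * z * (u z)\<^sup>2) = inner_L2 (H_op w) w + (u 0)\<^sup>2"
    using integral_leb_neg(2)[OF Ea] integral_unique[OF E] by simp
  have "(norm_L2 w)\<^sup>2 = inner_L2 w w"
    by (simp add: norm_L2_def inner_L2_def)
  also have "\<dots> = integral {..<0} (\<lambda>z. (w z)\<^sup>2)"
    using integral_leb_neg(2)[OF L2_neg_square[OF w]] by (simp add: inner_L2_def power2_eq_square)
  also have "\<dots> = M"
    unfolding M_def by (rule integral_spike[OF N]) (use uw in auto)
  finally have norm: "(norm_L2 w)\<^sup>2 = M" .
  have "regular_representative w u"
    unfolding regular_representative_def
  proof (intro conjI)
    have "AE z in lebesgue. z \<in> {..<0} \<longrightarrow> u z = w z"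
      unfolding eventually_ae_filter_negligible using N uw by (intro exI[of _ N]) auto
    then show "AE z in leb_neg. u z = w z"
      by (subst AE_restrict_space_iff) auto
    show "continuous_on {..0} u"
      unfolding continuous_on_def
    proof
      fix z :: real assume "z \<in> {..0}"
      then consider "z < 0" | "z = 0" by force
      then show "(u \<longlongrightarrow> u z) (at z within {..0})"
      proof cases
        case 1
        show ?thesis
          by (rule tendsto_within_subset[OF _ subset_UNIV])
            (use DERIV_isCont[OF DERIV_u[OF 1]] in \<open>simp add: isCont_def\<close>)
      next
        case 2
        have "at (0::real) within {..0} = at_left 0"
          unfolding at_within_def by (rule arg_cong[where f = "\<lambda>S. inf (nhds 0) (principal S)"]) auto
        then show ?thesis
          using 2 u_limit_0 by (simp add: G0 u0)
      qed
    qed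
    show "u differentiable_on {..<0}"
      using DERIV_u by (meson differentiable_at_withinI differentiable_on_def lessThan_iff real_differentiable_def)
  qed
  \<comment> \<open>The energy integral alone already satisfies the bound; the boundary term has the
    favourable sign and is dropped.\<close>
  moreover have "- (u 0)\<^sup>2 + (inner_L2 (H_op w) w + (u 0)\<^sup>2) \<le> - (1 / 2) * M"
    using energy_integral_le[OF E] zero_le_power2[of "u 0"] by linarith
  ultimately show ?thesis
    using int LINT norm by (intro exI[of _ u]) simp
qed

end
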